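(* Let $e\in[0,1)$, and let $\mathcal C_1,\mathcal C_2$, $\Lambda_1,\Lambda_2$ and $\Lambda_{m_2}^{m_1}$, $(m_1,m_2)\in\Xi$, be parameters of the conservative spin-spin system as in the context. Assume the following three conditions: $$\frac{1}{\pi^2}>\frac{1}{(1-e)^3} \left(\frac{\Lambda_1}{\mathcal C_1}+\frac{\Lambda_2}{\mathcal C_2}\right) + \frac{1}{(1-e)^5} \sum_{(m_1,m_2)\in \Xi }\left(\frac{m_1^2}{\mathcal C_1}+\frac{m_2^2}{\mathcal C_2}\right)\Lambda_{m_2}^{m_1},$$ $$\frac{1}{4\pi} > M := \frac{1}{(1-e)^3} \max \left \{\frac{\Lambda_1}{\mathcal C_1},\frac{\Lambda_2}{\mathcal C_2} \right \}+\frac{1}{(1-e)^5} \sum_{(m_1,m_2)\in \Xi }\max \left \{\frac{|m_1|}{\mathcal C_1},\frac{|m_2|}{\mathcal C_2} \right \} \Lambda_{m_2}^{m_1} + \frac{4e\sqrt{1-e^2}}{(1-e)^4},$$ $$\cos (2\pi^2 M ) \min \left \{\frac{\Lambda_1}{\mathcal C_1},\frac{\Lambda_2}{\mathcal C_2} \right \} > \max \left \{\alpha_1\frac{\Lambda_1}{\mathcal C_1},\alpha_2 \frac{\Lambda_2}{\mathcal C_2} \right \},$$ where $\alpha_1,\alpha_2$ are defined by $$\alpha_j \frac{\Lambda_j}{\mathcal C_j} = \frac{1}{(1-e)^2} \sum_{(m_1,m_2)\in \Xi }\left(\frac{m_j^2}{\mathcal C_j}+\frac{|m_1m_2|}{\sqrt{\mathcal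 C_1\mathcal C_2}}\right)\Lambda_{m_2}^{m_1},\qquad j=1,2.$$ Then the odd $2\pi$-periodic solution $\Theta^*(t)$ of the conservative system $\mathcal C\ddot\Theta+F(t,\Theta)=0$ is strongly linearly stable.
   Context: Orbit: for $e\in[0,1)$ the eccentric anomaly $u=u(t)$ is defined by Kepler's equation $t=u-e\sin u$. Put $r(t)/a=1-e\cos u(t)$ ($a>0$ is the semimajor axis; only the ratio $a/r$ matters), and let $f(t)$ be the continuous function with $f(0)=0$ and $\frac{r(t)}{a}\exp(i f(t))=\cos u(t)-e+i\sqrt{1-e^2}\,\sin u(t)$ (true anomaly). These are real analytic in $t$, $r$ is even and $2\pi$-periodic, $f$ is odd and $f(t+2\pi)=f(t)+2\pi$. Parameters: $\Xi=\{(m_1,m_2)\in\mathbb Z^2: |m_1|+|m_2|\le 2\}$; $\mathcal C_1,\mathcal C_2>0$ with $\mathcal C_1+\mathcal C_2=1$; $\Lambda_1,\Lambda_2>0$; and $\Lambda_{m_2}^{m_1}>0$ for $(m_1,m_2)\in\Xi$, with $\Lambda_{m_2}^{m_1}=\Lambda_{-m_2}^{-m_1}$. Conservative spin-spin system: $\mathcal C\ddot\Theta+F(t,\Theta)=0$ for $\Theta=(\Theta_1,\Theta_2)^{\mathsf T}\in\mathbb R^2$, where $\mathcal C=\operatorname{diag}(\mathcal C_1,\mathcal C_2)$ and $$F(t,\Theta)=\left(\frac{a}{r(t)}\right)^{3}\begin{pmatrix}\Lambda_1\sin\Theta_1\\ \Lambda_2\sin\Theta_2\end{pmatrix}+\left(\frac{a}{r(t)}\right)^{5}\sum_{(m_1,m_2)\in\Xi}\begin{pmatrix}m_1\\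 m_2\end{pmatrix}\Lambda_{m_2}^{m_1}\sin(m_1\Theta_1+m_2\Theta_2)+2\ddot f(t)\begin{pmatrix}\mathcal C_1\\ \mathcal C_2\end{pmatrix}.$$ $\Theta^*$ denotes the solution of the Dirichlet problem $\mathcal C\ddot\Theta+F(t,\Theta)=0$, $\Theta(0)=\Theta(\pi)=0$ (it exists, and is unique under the hypotheses of the claim), extended to $\mathbb R$ as an odd $2\pi$-periodic solution. Strong stability: let $A_0(t)\in\mathbb R^{d\times d}$ be symmetric and $T$-periodic. The equation $\ddot y+A_0(t)y=0$ is strongly stable if there is $\varepsilon>0$ such that $\ddot y+A_*(t)y=0$ is stable (all solutions, together with their derivatives, are bounded on $\mathbb R$) for every symmetric $T$-periodic (locally integrable) $A_*(t)\in\mathbb R^{d\times d}$ with $\int_0^T\|A_*(t)-A_0(t)\|\,dt<\varepsilon$. $\Theta^*$ is called strongly linearly stable if the (scaled) linearized equation $\ddot y+A(t)y=0$ with the symmetric $2\pi$-periodic matrix $A(t)=\mathcal C^{-1/2}\,\partial_\Theta F(t,\Theta^*(t))\,\mathcal C^{-1/2}$, $\mathcal C^{-1/2}=\operatorname{diag}(\mathcal C_1^{-1/2},\mathcal C_2^{-1/2})$, is strongly stable (with $T=2\pi$, $d=2$). *)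

theory Defs
  imports "HOL-Analysis.Analysis"
begin

section \<open>Keplerian orbit\<close>

definition eccentric_anomaly :: "real \<Rightarrow> real \<Rightarrow> real" where
  "eccentric_anomaly e t = (THE u. t = u - e * sin u)"

text \<open>\<open>orbital_radius e t\<close> is the ratio \<open>r(t)/a\<close>; the semimajor axis itself never matters.\<close>

definition orbital_radius :: "real \<Rightarrow> real \<Rightarrow> real" where
  "orbital_radius e t = 1 - e * cos (eccentric_anomaly e t)"

definition is_true_anomaly :: "real \<Rightarrow> (real \<Rightarrow> real) \<Rightarrow> bool" where
  "is_true_anomaly e f \<longleftrightarrow>
     continuous_on UNIV f \<and> f 0 = 0 \<and>
     (\<forall>t. complex_of_real (orbital_radius e t) * exp (\<i> * complex_of_real (f t)) =
            Complex (cos (eccentric_anomaly e t) - e)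
                    (sqrt (1 - e\<^sup>2) * sin (eccentric_anomaly e t)))"

definition true_anomaly :: "real \<Rightarrow> real \<Rightarrow> real" where
  "true_anomaly e = (THE f. is_true_anomaly e f)"

section \<open>The conservative spin-spin system\<close>

definition Xi :: "(int \<times> int) set" where
  "Xi = {(m1, m2). \<bar>m1\<bar> + \<bar>m2\<bar> \<le> 2}"

definition diag2 :: "real \<Rightarrow> real \<Rightarrow> real ^ 2 ^ 2" where
  "diag2 a b = vector [vector [a, 0], vector [0, b]]"

text \<open>\<open>\<Lambda> m1 m2\<close> is the coefficient with upper index \<open>m1\<close> and lower index \<open>m2\<close>.
  Only its values for \<open>(m1, m2) \<in> Xi\<close> are used.\<close>

definition spin_force ::
  "real \<Rightarrow> real \<Rightarrow> real \<Rightarrow> real \<Rightarrow> real \<Rightarrow> (int \<Rightarrow> int \<Rightarrow> real) \<Rightarrow> real \<Rightarrow> real ^ 2 \<Rightarrow> real ^ 2" where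
  "spin_force e C1 C2 \<Lambda>1 \<Lambda>2 \<Lambda> t \<theta> =
     (1 / orbital_radius e t) ^ 3 *\<^sub>R vector [\<Lambda>1 * sin (\<theta> $ 1), \<Lambda>2 * sin (\<theta> $ 2)]
   + (1 / orbital_radius e t) ^ 5 *\<^sub>R
       (\<Sum>(m1, m2)\<in>Xi. (\<Lambda> m1 m2 * sin (of_int m1 * \<theta> $ 1 + of_int m2 * \<theta> $ 2)) *\<^sub>R
          vector [of_int m1, of_int m2])
   + (2 * deriv (deriv (true_anomaly e)) t) *\<^sub>R vector [C1, C2]"

definition spin_solution_on ::
  "real set \<Rightarrow> real \<Rightarrow> real \<Rightarrow> real \<Rightarrow> real \<Rightarrow> real \<Rightarrow> (int \<Rightarrow> int \<Rightarrow> real) \<Rightarrow> (real \<Rightarrow> real ^ 2) \<Rightarrow> bool"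
  where
  "spin_solution_on S e C1 C2 \<Lambda>1 \<Lambda>2 \<Lambda> \<Theta> \<longleftrightarrow>
     (\<exists>\<Theta>' \<Theta>''. \<forall>t\<in>S.
        (\<Theta> has_vector_derivative \<Theta>' t) (at t within S) \<and>
        (\<Theta>' has_vector_derivative \<Theta>'' t) (at t within S) \<and>
        diag2 C1 C2 *v \<Theta>'' t + spin_force e C1 C2 \<Lambda>1 \<Lambda>2 \<Lambda> t (\<Theta> t) = 0)"

definition Dirichlet_solution ::
  "real \<Rightarrow> real \<Rightarrow> real \<Rightarrow> real \<Rightarrow> real \<Rightarrow> (int \<Rightarrow> int \<Rightarrow> real) \<Rightarrow> (real \<Rightarrow> real ^ 2) \<Rightarrow> bool" where
  "Dirichlet_solution e C1 C2 \<Lambda>1 \<Lambda>2 \<Lambda> \<Theta> \<longleftrightarrow>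
     spin_solution_on {0..pi} e C1 C2 \<Lambda>1 \<Lambda>2 \<Lambda> \<Theta> \<and> \<Theta> 0 = 0 \<and> \<Theta> pi = 0"

text \<open>The solution of the Dirichlet problem on \<open>[0, \<pi>]\<close>, extended to the real line as an odd
  \<open>2\<pi>\<close>-periodic solution. Since this is a definite description, nothing can be shown about
  \<open>\<Theta>_star\<close> without first showing that exactly one such function exists.\<close>

definition \<Theta>_star ::
  "real \<Rightarrow> real \<Rightarrow> real \<Rightarrow> real \<Rightarrow> real \<Rightarrow> (int \<Rightarrow> int \<Rightarrow> real) \<Rightarrow> real \<Rightarrow> real ^ 2" where
  "\<Theta>_star e C1 C2 \<Lambda>1 \<Lambda>2 \<Lambda> =
     (THE \<Theta>. Dirichlet_solution e C1 C2 \<Lambda>1 \<Lambda>2 \<Lambda> \<Theta> \<and>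
        spin_solution_on UNIV e C1 C2 \<Lambda>1 \<Lambda>2 \<Lambda> \<Theta> \<and>
        (\<forall>t. \<Theta> (- t) = - \<Theta> t) \<and> (\<forall>t. \<Theta> (t + 2 * pi) = \<Theta> t))"

section \<open>Strong stability of Hill systems\<close>

text \<open>The data of \<open>y'' + A(t) y = 0\<close>: symmetric, \<open>T\<close>-periodic, locally (Lebesgue) integrable.\<close>

definition Hill_coefficient :: "real \<Rightarrow> (real \<Rightarrow> real ^ 'n ^ 'n) \<Rightarrow> bool" where
  "Hill_coefficient T A \<longleftrightarrow>
     (\<forall>t. transpose (A t) = A t) \<and> (\<forall>t. A (t + T) = A t) \<and>
     (\<forall>a b. A absolutely_integrable_on {a..b})"

text \<open>Solutions for locally integrable coefficients are understood in the Caratheodory sense: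
  \<open>y\<close> is continuously differentiable and its derivative \<open>v\<close> is an indefinite integral
  of \<open>- A y\<close>.\<close>

definition Hill_solution ::
  "(real \<Rightarrow> real ^ 'n ^ 'n) \<Rightarrow> (real \<Rightarrow> real ^ 'n) \<Rightarrow> (real \<Rightarrow> real ^ 'n) \<Rightarrow> bool" where
  "Hill_solution A y v \<longleftrightarrow>
     (\<forall>t. (y has_vector_derivative v t) (at t)) \<and>
     (\<forall>a b. a \<le> b \<longrightarrow> ((\<lambda>s. - (A s *v y s)) has_integral (v b - v a)) {a..b})"

definition Hill_stable :: "(real \<Rightarrow> real ^ 'n ^ 'n) \<Rightarrow> bool" where
  "Hill_stable A \<longleftrightarrow>
     (\<forall>y v. Hill_solution A y v \<longrightarrow> bounded (range y) \<and> bounded (range v))"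

text \<open>The norm below is the Frobenius norm; the notion does not depend on the choice of
  matrix norm.\<close>

definition strongly_stable :: "real \<Rightarrow> (real \<Rightarrow> real ^ 'n ^ 'n) \<Rightarrow> bool" where
  "strongly_stable T A0 \<longleftrightarrow>
     Hill_coefficient T A0 \<and>
     (\<exists>\<epsilon>>0. \<forall>A. Hill_coefficient T A \<and> integral {0..T} (\<lambda>t. norm (A t - A0 t)) < \<epsilon> \<longrightarrow>
        Hill_stable A)"

definition linearization ::
  "real \<Rightarrow> real \<Rightarrow> real \<Rightarrow> real \<Rightarrow> real \<Rightarrow> (int \<Rightarrow> int \<Rightarrow> real) \<Rightarrow> (real \<Rightarrow> real ^ 2) \<Rightarrow> real \<Rightarrow> real ^ 2 ^ 2"
  where
  "linearization e C1 C2 \<Lambda>1 \<Lambda>2 \<Lambda> \<Theta> t =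
     diag2 (1 / sqrt C1) (1 / sqrt C2)
     ** jacobian (spin_force e C1 C2 \<Lambda>1 \<Lambda>2 \<Lambda> t) (at (\<Theta> t))
     ** diag2 (1 / sqrt C1) (1 / sqrt C2)"

definition strongly_linearly_stable ::
  "real \<Rightarrow> real \<Rightarrow> real \<Rightarrow> real \<Rightarrow> real \<Rightarrow> (int \<Rightarrow> int \<Rightarrow> real) \<Rightarrow> (real \<Rightarrow> real ^ 2) \<Rightarrow> bool" where
  "strongly_linearly_stable e C1 C2 \<Lambda>1 \<Lambda>2 \<Lambda> \<Theta> \<longleftrightarrow>
     strongly_stable (2 * pi) (linearization e C1 C2 \<Lambda>1 \<Lambda>2 \<Lambda> \<Theta>)"

section \<open>Well-definedness of the orbit\<close>

lemma finite_Xi: "finite Xi"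
proof (rule finite_subset)
  show "Xi \<subseteq> {-2..2} \<times> {-2..2}" by (auto simp: Xi_def)
qed simp

lemma kepler_strict_mono:
  assumes e: "0 \<le> e" "e < 1" and "u < (w::real)"
  shows "u - e * sin u < w - e * sin w"
proof (rule DERIV_pos_imp_increasing[OF \<open>u < w\<close>])
  fix x :: real
  have "e * cos x \<le> e" using e by (simp add: mult_left_le)
  moreover have "((\<lambda>u. u - e * sin u) has_real_derivative 1 - e * cos x) (at x)"
    by (auto intro!: derivative_eq_intros)
  ultimately show "\<exists>y. ((\<lambda>u. u - e * sin u) has_real_derivative y) (at x) \<and> 0 < y"
    using e by (intro exI[of _ "1 - e * cos x"]) auto
qed

lemma kepler_ex1:
  assumes e: "0 \<le> e" "e < 1"
  shows "\<exists>!u::real. t = u - e * sin u"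
proof (rule ex_ex1I)
  have s: "\<bar>e * sin x\<bar> \<le> 1" for x
    using e by (simp add: abs_mult mult_le_one)
  have "\<exists>x\<ge>t - 1. x \<le> t + 1 \<and> x - e * sin x = t"
    using s[of "t - 1"] s[of "t + 1"] by (intro IVT') (auto intro!: continuous_intros)
  then show "\<exists>u. t = u - e * sin u" by auto
next
  fix u w assume "t = u - e * sin u" "t = w - e * sin w"
  then show "u = w"
    using kepler_strict_mono[OF e, of u w] kepler_strict_mono[OF e, of w u] by linarith
qed

lemma eccentric_anomaly_eq:
  assumes "0 \<le> e" "e < 1"
  shows "t = eccentric_anomaly e t - e * sin (eccentric_anomaly e t)"
  unfolding eccentric_anomaly_def by (rule theI'[OF kepler_ex1[OF assms]])

lemma eccentric_anomaly_unique:
  assumes "0 \<le> e" "e < 1" "t = u - e * sin u"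
  shows "eccentric_anomaly e t = u"
  using kepler_ex1[OF assms(1,2), of t] eccentric_anomaly_eq[OF assms(1,2), of t] assms(3)
  by blast

lemma continuous_eccentric_anomaly:
  assumes e: "0 \<le> e" "e < 1"
  shows "continuous_on UNIV (eccentric_anomaly e)"
proof -
  let ?E = "eccentric_anomaly e"
  have lip: "(1 - e) * \<bar>?E s - ?E t\<bar> \<le> \<bar>s - t\<bar>" for s t
  proof -
    have "\<bar>sin (?E s) - sin (?E t)\<bar> \<le> \<bar>?E s - ?E t\<bar>"
    proof -
      have "sin (?E s) - sin (?E t) = 2 * sin ((?E s - ?E t) / 2) * cos ((?E s + ?E t) / 2)"
        by (rule sin_diff_sin)
      then have "\<bar>sin (?E s) - sin (?E t)\<bar> =
          2 * \<bar>sin ((?E s - ?E t) / 2)\<bar> * \<bar>cos ((?E s + ?E t) / 2)\<bar>"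
        by (simp add: abs_mult)
      also have "\<dots> \<le> 2 * \<bar>(?E s - ?E t) / 2\<bar> * 1"
        by (intro mult_mono abs_sin_x_le_abs_x) auto
      finally show ?thesis by simp
    qed
    then have "e * \<bar>sin (?E s) - sin (?E t)\<bar> \<le> e * \<bar>?E s - ?E t\<bar>"
      using e by (intro mult_left_mono) auto
    moreover have "s - t = (?E s - ?E t) - e * (sin (?E s) - sin (?E t))"
      using eccentric_anomaly_eq[OF e, of s] eccentric_anomaly_eq[OF e, of t]
      by (simp add: right_diff_distrib)
    moreover have "\<bar>e * (sin (?E s) - sin (?E t))\<bar> = e * \<bar>sin (?E s) - sin (?E t)\<bar>"
      using e by (simp add: abs_mult)
    ultimately show ?thesis by (simp add: left_diff_distrib)
  qed
  show ?thesis
  proof (rule lipschitz_on_continuous_on[of "1 / (1 - e)"], rule lipschitz_onI)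
    show "dist (?E s) (?E t) \<le> 1 / (1 - e) * dist s t" for s t
      using lip[of s t] e by (simp add: dist_real_def field_simps)
  qed (use e in auto)
qed

lemma true_anomaly_ex1:
  assumes e: "0 \<le> e" "e < 1"
  shows "\<exists>!f. is_true_anomaly e f"
proof -
  let ?E = "eccentric_anomaly e"
  define z where "z t = Complex (cos (?E t) - e) (sqrt (1 - e\<^sup>2) * sin (?E t))" for t
  have rpos: "orbital_radius e t > 0" for t
  proof -
    have "e * cos (?E t) \<le> e" using e by (simp add: mult_left_le)
    then show ?thesis using e by (simp add: orbital_radius_def)
  qed
  have e2: "e\<^sup>2 \<le> 1" using e by (simp add: power_le_one)
  have normz: "cmod (z t) = orbital_radius e t" for t
  proof -
    have "(cos (?E t) - e)\<^sup>2 + (sqrt (1 - e\<^sup>2) * sin (?E t))\<^sup>2 = (orbital_radius e t)\<^sup>2"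
      using e2 by (simp add: power_mult_distrib orbital_radius_def sin_squared_eq)
        (simp add: power2_eq_square algebra_simps)
    then show ?thesis using rpos[of t] by (simp add: z_def cmod_def)
  qed
  have E0: "?E 0 = 0" by (rule eccentric_anomaly_unique[OF e]) simp
  have contz: "continuous_on UNIV z"
    unfolding z_def Complex_eq
    by (intro continuous_intros continuous_on_cos continuous_on_sin
        continuous_eccentric_anomaly[OF e])
  have z0: "z t \<noteq> 0" for t using normz[of t] rpos[of t] by auto
  obtain g where g: "continuous_on UNIV g" "\<And>t. z t = exp (g t)"
    using continuous_logarithm_on_contractible[OF contz] z0
    by (metis UNIV_I convex_UNIV convex_imp_contractible)
  have zg: "z t = complex_of_real (orbital_radius e t) * exp (\<i> * complex_of_real (Im (g t)))" for t
  proof -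
    have "orbital_radius e t = exp (Re (g t))"
      using normz[of t] by (simp add: g(2)[of t])
    then show ?thesis
      using exp_eq_polar[of "g t"] by (simp add: g(2)[of t] cis_conv_exp)
  qed
  have exp0: "exp (\<i> * complex_of_real (Im (g 0))) = 1"
  proof -
    have "z 0 = complex_of_real (orbital_radius e 0)"
      by (simp add: z_def E0 orbital_radius_def complex_eq_iff)
    then show ?thesis using zg[of 0] rpos[of 0] by simp
  qed
  define f where "f t = Im (g t) - Im (g 0)" for t
  have "exp (\<i> * complex_of_real (f t)) = exp (\<i> * complex_of_real (Im (g t)))" for t
    by (simp add: f_def right_diff_distrib exp_diff exp0)
  then have "is_true_anomaly e f"
    unfolding is_true_anomaly_def using zg
    by (auto simp: f_def z_def intro!: continuous_intros g(1))
  moreover have "h = k" if h: "is_true_anomaly e h" and k: "is_true_anomaly e k" for h k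
  proof -
    let ?d = "\<lambda>t. h t - k t"
    have int: "\<exists>n::int. ?d t = of_int n * (2 * pi)" for t
    proof -
      have "exp (\<i> * complex_of_real (h t)) = exp (\<i> * complex_of_real (k t))"
        using h k rpos[of t] unfolding is_true_anomaly_def
        by (metis less_irrefl mult_cancel_left of_real_eq_0_iff)
      then obtain n where "\<i> * complex_of_real (h t) =
          \<i> * complex_of_real (k t) + complex_of_real (2 * of_int n * pi) * \<i>"
        by (auto simp: exp_eq)
      then have "h t = k t + 2 * of_int n * pi"
        by (simp add: complex_eq_iff)
      then show ?thesis by (auto intro!: exI[of _ n])
    qed
    have "?d constant_on UNIV"
    proof (rule continuous_discrete_range_constant)
      show "continuous_on UNIV ?d"
        using h k by (auto simp: is_true_anomaly_def intro!: continuous_intros)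
      show "\<exists>\<epsilon>>0. \<forall>y. y \<in> UNIV \<and> ?d y \<noteq> ?d x \<longrightarrow> \<epsilon> \<le> norm (?d y - ?d x)" for x
      proof (intro exI[of _ "2 * pi"] conjI allI impI)
        fix y assume ne: "y \<in> UNIV \<and> ?d y \<noteq> ?d x"
        obtain m n :: int where mn: "?d y = of_int m * (2 * pi)" "?d x = of_int n * (2 * pi)"
          using int by blast
        then have "m \<noteq> n" using ne by auto
        then have "1 \<le> \<bar>real_of_int (m - n)\<bar>" by linarith
        moreover have "?d y - ?d x = of_int (m - n) * (2 * pi)"
          unfolding mn by (simp add: algebra_simps)
        ultimately show "2 * pi \<le> norm (?d y - ?d x)"
          by (simp add: abs_mult del: of_int_diff)
      qed simp
    qed simp
    moreover have "?d 0 = 0" using h k by (simp add: is_true_anomaly_def)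
    ultimately show "h = k"
      unfolding constant_on_def fun_eq_iff by (metis UNIV_I eq_iff_diff_eq_0)
  qed
  ultimately show ?thesis by blast
qed

end

theory Submission
  imports Defs
begin

text \<open>
  Let \<open>y\<close> solve \<open>y'' + A y = 0\<close> with \<open>A\<close> symmetric and \<open>T\<close>-periodic. The Wronskian
  \<open>q = y(T) \<bullet> y'(0) - y'(T) \<bullet> y(0)\<close> of \<open>y(\<cdot> + T)\<close> and \<open>y\<close> does not change when \<open>y\<close> is translated by
  multiples of \<open>T\<close>. With \<open>s = (y(0) + y(T)) / 2\<close> and \<open>h = y - s\<close> it equals
  \<open>\<integral> (|y'|\<^sup>2 + A s \<bullet> s - A h \<bullet> h)\<close> over \<open>[0, T]\<close>, and \<open>h(T) = - h(0)\<close> gives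
  \<open>|h|\<^sup>2 \<le> T / 4 \<integral> |y'|\<^sup>2\<close>. So if \<open>A\<close> is bounded below by \<open>\<delta> > 0\<close> and above by \<open>\<lambda>\<close> with
  \<open>\<lambda> T\<^sup>2 < 4\<close>, then \<open>q\<close> controls the size of \<open>y\<close> and \<open>y'\<close> on every period; these bounds survive a
  perturbation of \<open>A\<close> that is small in \<open>L\<^sup>1\<close>.

  In the variables \<open>C\<^sup>1\<^sup>/\<^sup>2 \<Theta>\<close> the force has Lipschitz constant below \<open>1 / \<pi>\<^sup>2\<close> by the first
  hypothesis. Inverting the second derivative on odd \<open>2\<pi>\<close>-periodic functions costs at most
  \<open>\<pi>\<^sup>2\<close>, so \<open>\<Theta>_star\<close> is the fixed point of a contraction, and the same constant is an upper bound
  \<open>\<lambda>\<close> for the linearization. The second hypothesis gives \<open>|\<Theta>_j''| \<le> M\<close>, hence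
  \<open>|\<Theta>_j| \<le> \<pi>\<^sup>2 M\<close>, and the third one then makes the linearization diagonally dominant, hence
  bounded below.
\<close>

section \<open>Hill systems\<close>

lemma vector_derivative_zero_imp_eq:
  fixes f :: "real \<Rightarrow> 'a::real_normed_vector"
  assumes "\<And>t. (f has_vector_derivative 0) (at t)"
  shows "f s = f t"
proof -
  obtain c where "\<And>x. x \<in> UNIV \<Longrightarrow> f x = c"
    using has_vector_derivative_zero_constant[of UNIV f] assms by auto
  then show ?thesis by simp
qed

lemma has_vector_derivative_shift:
  assumes "(f has_vector_derivative d) (at (t + c))"
  shows "((\<lambda>t. f (t + c)) has_vector_derivative d) (at t)"
proof -
  have "((f \<circ> (\<lambda>t. t + c)) has_vector_derivative 1 *\<^sub>R d) (at t)"
    using assms by (intro vector_diff_chain_at) (auto intro!: derivative_eq_intros)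
  then show ?thesis by (simp add: o_def)
qed

lemma has_vector_derivative_reflect:
  assumes "(f has_vector_derivative d) (at (- t))"
  shows "((\<lambda>t. f (- t)) has_vector_derivative - d) (at t)"
proof -
  have "((f \<circ> uminus) has_vector_derivative (-1) *\<^sub>R d) (at t)"
    using assms by (intro vector_diff_chain_at) (auto intro!: derivative_eq_intros)
  then show ?thesis by (simp add: o_def)
qed

text \<open>The interval version of the fundamental theorem is used with infinite ends, so one
  antiderivative serves the whole line and is differentiable on both sides of every point.\<close>

lemma continuous_has_antiderivative:
  fixes g :: "real \<Rightarrow> 'a::euclidean_space"
  assumes "continuous_on UNIV g"
  obtains G where "\<And>t. (G has_vector_derivative g t) (at t)"
  using einterval_antiderivative[of "-\<infinity>" "\<infinity>" g] assms
  by (auto simp: continuous_on_eq_continuous_at)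

lemma has_vector_derivative_imp_continuous_on:
  assumes "\<And>t. (f has_vector_derivative f' t) (at t)"
  shows "continuous_on S f"
  using assms by (auto intro!: continuous_at_imp_continuous_on has_vector_derivative_continuous)

text \<open>Here \<open>v\<close> is only absolutely continuous. The difference \<open>\<Phi>\<close> of both sides has derivative
  zero everywhere, because its increment over \<open>[s, t]\<close> is at most a multiple of \<open>t - s\<close> times the
  integral of \<open>norm g\<close> over \<open>[s, t]\<close>.\<close>

lemma has_integral_inner_by_parts:
  fixes g v h h' :: "real \<Rightarrow> 'a::euclidean_space"
  assumes ab: "a \<le> b"
    and g: "g absolutely_integrable_on {a..b}"
    and v: "\<And>s t. a \<le> s \<Longrightarrow> s \<le> t \<Longrightarrow> t \<le> b \<Longrightarrow> (g has_integral (v t - v s)) {s..t}"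
    and h: "\<And>t. t \<in> {a..b} \<Longrightarrow> (h has_vector_derivative h' t) (at t within {a..b})"
    and h': "continuous_on {a..b} h'"
  shows "((\<lambda>t. v t \<bullet> h' t + g t \<bullet> h t) has_integral (v b \<bullet> h b - v a \<bullet> h a)) {a..b}"
proof -
  \<comment> \<open>\<open>N\<close> is monotone and continuous and dominates the increments of
    \<open>v\<close>; it takes the place of a Lipschitz bound, which \<open>v\<close> need not
    have.\<close>
  define N where "N t = integral {a..t} (\<lambda>s. norm (g s))" for t
  define w where "w t = v t \<bullet> h' t + g t \<bullet> h t" for t
  have gi: "g integrable_on {a..b}" and ngi: "(\<lambda>s. norm (g s)) integrable_on {a..b}"
    using g by (auto simp: absolutely_integrable_on_def)
  have conth: "continuous_on {a..b} h"
    using h by (meson continuous_on_vector_derivative)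
  have vint: "v t = v a + integral {a..t} g" if "t \<in> {a..b}" for t
    using v[of a t] that by (auto simp: has_integral_iff)
  have contv: "continuous_on {a..b} v"
    by (intro continuous_on_eq[of _ "\<lambda>t. v a + integral {a..t} g" v] vint[symmetric]
        continuous_intros indefinite_integral_continuous_1[OF gi])
  have contN: "continuous_on {a..b} N"
    unfolding N_def by (rule indefinite_integral_continuous_1[OF ngi])
  have N: "integral {s..t} (\<lambda>s. norm (g s)) = N t - N s" if "a \<le> s" "s \<le> t" "t \<le> b" for s t
    using Henstock_Kurzweil_Integration.integral_combine[of a s t "\<lambda>s. norm (g s)"] that
      integrable_subinterval_real[OF ngi, of a t]
    by (auto simp: N_def)
  have vN: "norm (v t - v s) \<le> N t - N s" if "a \<le> s" "s \<le> t" "t \<le> b" for s t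
  proof -
    have "{s..t} \<subseteq> {a..b}" using that by auto
    then have "norm (integral {s..t} g) \<le> integral {s..t} (\<lambda>s. norm (g s))"
      by (intro integral_norm_bound_integral integrable_subinterval_real[OF gi]
        integrable_subinterval_real[OF ngi]) auto
    then show ?thesis using N[OF that] v[OF that] by (auto simp: has_integral_iff)
  qed
  obtain L where L: "L > 0" "\<And>t. t \<in> {a..b} \<Longrightarrow> norm (h' t) \<le> L"
    using compact_imp_bounded[OF compact_continuous_image[OF h']]
    by (auto simp: bounded_pos)
  have hL: "norm (h t - h s) \<le> L * \<bar>t - s\<bar>" if "s \<in> {a..b}" "t \<in> {a..b}" for s t
    using differentiable_bound[of "{a..b}" h "\<lambda>t d. d *\<^sub>R h' t" L t s] h that L
    by (auto simp: has_vector_derivative_def onorm_scaleR_left bounded_linear_ident onorm_id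
        real_norm_def)
  have gh: "(\<lambda>t. g t \<bullet> h t) absolutely_integrable_on {a..b}"
  proof -
    \<comment> \<open>The arguments are swapped because the product rule for integrability expects
      the bounded measurable factor, here \<open>h\<close>, in first position.\<close>
    have "bilinear (\<lambda>(x::'a) y. y \<bullet> x)"
      by (auto simp: bilinear_def linear_iff inner_simps)
    then show ?thesis
      using absolutely_integrable_bounded_measurable_product[of "\<lambda>x y. y \<bullet> x" h "{a..b}" g] g
        compact_imp_bounded[OF compact_continuous_image[OF conth]] conth
      by (simp add: continuous_imp_measurable_on_sets_lebesgue)
  qed
  have wi: "w integrable_on {a..b}"
    unfolding w_def
  proof (rule integrable_add)
    show "(\<lambda>t. v t \<bullet> h' t) integrable_on {a..b}"
      using contv h' by (intro integrable_continuous_interval continuous_intros)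
  qed (use gh in \<open>auto simp: absolutely_integrable_on_def\<close>)
  define \<Phi> where "\<Phi> t = v t \<bullet> h t - integral {a..t} w" for t
  have key: "\<bar>\<Phi> t - \<Phi> s\<bar> \<le> 2 * L * \<bar>N t - N s\<bar> * (t - s)" if st: "a \<le> s" "s \<le> t" "t \<le> b" for s t
  proof -
    have sub: "{s..t} \<subseteq> {a..b}" using st by auto
    have gst: "g integrable_on {s..t}" by (rule integrable_subinterval_real[OF gi sub])
    have "(h' has_integral (h t - h s)) {s..t}"
      using sub st(2) by (intro fundamental_theorem_of_calculus)
        (auto intro: has_vector_derivative_within_subset[OF h])
    then have i1: "((\<lambda>\<tau>. v t \<bullet> h' \<tau>) has_integral v t \<bullet> (h t - h s)) {s..t}"
      using has_integral_linear[of h' "h t - h s" "{s..t}" "\<lambda>x. v t \<bullet> x"]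
      by (auto simp: o_def bounded_linear_inner_right)
    have i2: "((\<lambda>\<tau>. g \<tau> \<bullet> h s) has_integral (v t - v s) \<bullet> h s) {s..t}"
      using has_integral_linear[OF v[OF st], of "\<lambda>x. x \<bullet> h s"]
      by (auto simp: o_def bounded_linear_inner_left)
    have i3: "(w has_integral (integral {s..t} w)) {s..t}"
      using integrable_subinterval_real[OF wi sub] by blast
    \<comment> \<open>With \<open>v\<close> frozen at \<open>t\<close> and \<open>h\<close> frozen
      at \<open>s\<close> the integral is explicit. Subtracting \<open>w\<close> leaves two products
      of small factors: an increment of \<open>v\<close> with \<open>h'\<close>, and
      \<open>g\<close> with an increment of \<open>h\<close>.\<close>
    have "((\<lambda>\<tau>. v t \<bullet> h' \<tau> + g \<tau> \<bullet> h s - w \<tau>) has_integral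
         (v t \<bullet> (h t - h s) + (v t - v s) \<bullet> h s - integral {s..t} w)) {s..t}"
      by (intro has_integral_diff has_integral_add i1 i2 i3)
    moreover have "v t \<bullet> (h t - h s) + (v t - v s) \<bullet> h s - integral {s..t} w = \<Phi> t - \<Phi> s"
      using Henstock_Kurzweil_Integration.integral_combine[of a s t w] st integrable_subinterval_real[OF wi, of a t]
      by (auto simp: \<Phi>_def inner_simps)
    moreover have "v t \<bullet> h' \<tau> + g \<tau> \<bullet> h s - w \<tau> = (v t - v \<tau>) \<bullet> h' \<tau> + g \<tau> \<bullet> (h s - h \<tau>)" for \<tau>
      by (simp add: w_def inner_simps)
    ultimately have I: "((\<lambda>\<tau>. (v t - v \<tau>) \<bullet> h' \<tau> + g \<tau> \<bullet> (h s - h \<tau>)) has_integral (\<Phi> t - \<Phi> s)) {s..t}"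
      by simp
    have J: "((\<lambda>\<tau>. (N t - N s) * L + norm (g \<tau>) * (L * (t - s))) has_integral
        (N t - N s) * L * (t - s) + (N t - N s) * (L * (t - s))) {s..t}"
      using has_integral_const_real[of "(N t - N s) * L" s t] N[OF st] st
        integrable_subinterval_real[OF ngi sub]
      by (intro has_integral_add has_integral_mult_left) (auto simp: has_integral_iff algebra_simps)
    have "norm (\<Phi> t - \<Phi> s) \<le> (N t - N s) * L * (t - s) + (N t - N s) * (L * (t - s))"
    proof (rule order_trans[OF integral_norm_bound_integral[OF has_integral_integrable[OF I]
          has_integral_integrable[OF J], unfolded integral_unique[OF I] integral_unique[OF J]]])
      show "norm ((v t - v \<tau>) \<bullet> h' \<tau> + g \<tau> \<bullet> (h s - h \<tau>)) \<le> (N t - N s) * L + norm (g \<tau>) * (L * (t - s))"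
        if "\<tau> \<in> {s..t}" for \<tau>
      proof -
        have 1: "\<bar>(v t - v \<tau>) \<bullet> h' \<tau>\<bar> \<le> (N t - N s) * L"
        proof -
          have "norm (v t - v \<tau>) \<le> N t - N \<tau>" "norm (v \<tau> - v s) \<le> N \<tau> - N s"
            using vN[of \<tau> t] vN[of s \<tau>] st that by auto
          then have "norm (v t - v \<tau>) \<le> N t - N s" "0 \<le> N t - N s"
            using norm_ge_zero[of "v \<tau> - v s"] norm_ge_zero[of "v t - v \<tau>"] by linarith+
          then show ?thesis
            using L(2)[of \<tau>] that st
            by (intro order_trans[OF Cauchy_Schwarz_ineq2] mult_mono) auto
        qed
        have "norm (h s - h \<tau>) \<le> L * (t - s)"
        proof -
          have "norm (h s - h \<tau>) \<le> L * \<bar>s - \<tau>\<bar>" using hL[of \<tau> s] that st by auto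
          also have "\<dots> \<le> L * (t - s)" using that L by (intro mult_left_mono) auto
          finally show ?thesis .
        qed
        then have "\<bar>g \<tau> \<bullet> (h s - h \<tau>)\<bar> \<le> norm (g \<tau>) * (L * (t - s))"
          by (intro order_trans[OF Cauchy_Schwarz_ineq2] mult_left_mono) auto
        with 1 show ?thesis by simp
      qed
    qed auto
    moreover have "N t - N s \<ge> 0" using vN[OF st] norm_ge_zero order_trans by blast
    ultimately show ?thesis by (simp add: algebra_simps)
  qed
  have "(\<Phi> has_derivative (\<lambda>_. 0)) (at x within {a..b})" if x: "x \<in> {a..b}" for x
  \<comment> \<open>The difference quotient of \<open>\<Phi>\<close> at \<open>x\<close> is squeezed
    by \<open>2 * L * \<bar>N y - N x\<bar>\<close>, which tends to 0 because \<open>N\<close> is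
    continuous.\<close>
  proof (rule has_derivativeI_sandwich[of 1 _ _ _ _ "\<lambda>y. 2 * L * \<bar>N y - N x\<bar>"])
    show "norm (\<Phi> y - \<Phi> x - 0) / norm (y - x) \<le> 2 * L * \<bar>N y - N x\<bar>"
      if "y \<in> {a..b}" "y \<noteq> x" for y
    proof (cases "x < y")
      case True
      then show ?thesis using key[of x y] that x by (simp add: field_simps)
    next
      case False
      then show ?thesis using key[of y x] that x
        by (simp add: field_simps abs_minus_commute)
    qed
    have "((\<lambda>y. 2 * L * \<bar>N y - N x\<bar>) \<longlongrightarrow> 2 * L * \<bar>N x - N x\<bar>) (at x within {a..b})"
      using contN x by (intro tendsto_intros) (auto simp: continuous_on_def)
    then show "((\<lambda>y. 2 * L * \<bar>N y - N x\<bar>) \<longlongrightarrow> 0) (at x within {a..b})" by simp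
  qed auto
  then have "\<Phi> b = \<Phi> a"
    using has_derivative_zero_unique[of "{a..b}" \<Phi> b a] ab by auto
  then have "integral {a..b} w = v b \<bullet> h b - v a \<bullet> h a"
    by (simp add: \<Phi>_def)
  then show ?thesis using wi unfolding w_def by (simp add: has_integral_iff)
qed

section \<open>Regularity and Wronskian of Caratheodory solutions\<close>

lemma norm_matrix_vector_mult_le: "norm (A *v x) \<le> norm A * norm (x :: real ^ 'n)"
  for A :: "real ^ 'n ^ 'm"
proof -
  have "norm (A *v x) = L2_set (\<lambda>i. \<bar>A $ i \<bullet> x\<bar>) UNIV"
    by (simp add: norm_vec_def matrix_mult_dot)
  \<comment> \<open>Cauchy-Schwarz is applied row by row, so the norm that comes out is the
    Frobenius norm.\<close>
  also have "\<dots> \<le> L2_set (\<lambda>i. norm (A $ i) * norm x) UNIV"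
    by (intro L2_set_mono Cauchy_Schwarz_ineq2) auto
  also have "\<dots> = norm A * norm x"
    by (simp add: norm_vec_def[of A] L2_set_left_distrib)
  finally show ?thesis .
qed

lemma absolutely_integrable_matrix_vector_mult:
  fixes A :: "real \<Rightarrow> real ^ 'n ^ 'm"
  assumes A: "A absolutely_integrable_on {a..b}" and y: "continuous_on {a..b} y"
  shows "(\<lambda>t. A t *v y t) absolutely_integrable_on {a..b}"
proof -
  have "bilinear (\<lambda>(x::real ^ 'n) (A::real ^ 'n ^ 'm). A *v x)"
    by (auto simp: bilinear_def linear_iff matrix_vector_right_distrib matrix_vector_mult_scaleR
      matrix_vector_mult_add_rdistrib scaleR_matrix_vector_assoc)
  then show ?thesis
    using absolutely_integrable_bounded_measurable_product[of "\<lambda>x A. A *v x" y "{a..b}" A] A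
      compact_imp_bounded[OF compact_continuous_image[OF y]] y
    by (simp add: continuous_imp_measurable_on_sets_lebesgue)
qed

lemma symmetric_matrix_inner:
  "transpose A = A \<Longrightarrow> (A *v x) \<bullet> y = x \<bullet> (A *v y)" for A :: "real ^ 'n ^ 'n"
  by (metis dot_lmul_matrix transpose_matrix_vector)

text \<open>The velocity \<open>v\<close> is given only through its increments, so its continuity is
  that of an indefinite integral, checked near each \<open>t\<close> on
  \<open>[t - 1, t + 1]\<close>.\<close>

lemma Hill_solution_continuous:
  assumes A: "\<And>a b. A absolutely_integrable_on {a..b}" and sol: "Hill_solution A y v"
  shows "continuous_on S y" and "continuous_on S v"
    and "(\<lambda>t. - (A t *v y t)) absolutely_integrable_on {a..b}"
proof -
  have y: "continuous_on S y" for S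
    using sol unfolding Hill_solution_def by (blast intro: has_vector_derivative_imp_continuous_on)
  then show "continuous_on S y" .
  have g: "(\<lambda>t. - (A t *v y t)) absolutely_integrable_on {a..b}" for a b
    using absolutely_integrable_scaleR_left[OF absolutely_integrable_matrix_vector_mult[OF A y], of a b "-1"]
    by simp
  then show "(\<lambda>t. - (A t *v y t)) absolutely_integrable_on {a..b}" .
  have "isCont v t" for t
  proof -
    have "continuous_on {t-1..t+1} (\<lambda>x. v (t-1) + integral {t-1..x} (\<lambda>t. - (A t *v y t)))"
      using g by (intro continuous_intros indefinite_integral_continuous_1)
        (auto simp: absolutely_integrable_on_def)
    then have "continuous_on {t-1..t+1} v"
    proof (rule continuous_on_eq)
      fix x assume "x \<in> {t-1..t+1}"
      then have "((\<lambda>t. - (A t *v y t)) has_integral (v x - v (t-1))) {t-1..x}"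
        using sol by (auto simp: Hill_solution_def)
      then show "v (t-1) + integral {t-1..x} (\<lambda>t. - (A t *v y t)) = v x"
        by (simp add: has_integral_iff)
    qed
    then have "continuous_on {t-1<..<t+1} v"
      by (rule continuous_on_subset) auto
    then show ?thesis by (simp add: continuous_on_eq_continuous_at)
  qed
  then show "continuous_on S v" by (simp add: continuous_at_imp_continuous_on)
qed

text \<open>This is the weak form of the equation. The Wronskian and energy identities follow by
  testing with another solution or with \<open>y\<close> minus a constant.\<close>

lemma Hill_solution_by_parts:
  assumes A: "\<And>a b. A absolutely_integrable_on {a..b}" and sol: "Hill_solution A y v"
    and "a \<le> b" and h: "\<And>t. (h has_vector_derivative h' t) (at t)" and h': "continuous_on {a..b} h'"
  shows "((\<lambda>t. v t \<bullet> h' t - (A t *v y t) \<bullet> h t) has_integral (v b \<bullet> h b - v a \<bullet> h a)) {a..b}"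
proof -
  have "((\<lambda>t. v t \<bullet> h' t + (- (A t *v y t)) \<bullet> h t) has_integral (v b \<bullet> h b - v a \<bullet> h a)) {a..b}"
    using sol unfolding Hill_solution_def
    by (intro has_integral_inner_by_parts[OF \<open>a \<le> b\<close> Hill_solution_continuous(3)[OF A sol] _ _ h']
        has_vector_derivative_at_within[OF h]) auto
  then show ?thesis by simp
qed

text \<open>Each of the two equations is tested with the other solution. Since \<open>A t\<close> is
  symmetric the integrands coincide, hence so do the boundary terms.\<close>

lemma Hill_wronskian_constant:
  assumes A: "\<And>a b. A absolutely_integrable_on {a..b}" and sym: "\<And>t. transpose (A t) = A t"
    and sol: "Hill_solution A y v" "Hill_solution A z w"
  shows "z a \<bullet> v a - w a \<bullet> y a = z b \<bullet> v b - w b \<bullet> y b"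
proof -
  have *: "z a \<bullet> v a - w a \<bullet> y a = z b \<bullet> v b - w b \<bullet> y b" if "a \<le> b" for a b
  proof -
    have "((\<lambda>t. v t \<bullet> w t - (A t *v y t) \<bullet> z t) has_integral (v b \<bullet> z b - v a \<bullet> z a)) {a..b}"
      using sol that Hill_solution_continuous[OF A sol(2)]
      by (intro Hill_solution_by_parts[OF A]) (auto simp: Hill_solution_def)
    moreover have "((\<lambda>t. w t \<bullet> v t - (A t *v z t) \<bullet> y t) has_integral (w b \<bullet> y b - w a \<bullet> y a)) {a..b}"
      using sol that Hill_solution_continuous[OF A sol(1)]
      by (intro Hill_solution_by_parts[OF A]) (auto simp: Hill_solution_def)
    moreover have "v t \<bullet> w t - (A t *v y t) \<bullet> z t = w t \<bullet> v t - (A t *v z t) \<bullet> y t" for t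
      using symmetric_matrix_inner[OF sym, of t "y t" "z t"] by (simp add: inner_commute)
    ultimately show ?thesis
      using has_integral_unique[of "\<lambda>t. v t \<bullet> w t - (A t *v y t) \<bullet> z t" "v b \<bullet> z b - v a \<bullet> z a" "{a..b}"
          "w b \<bullet> y b - w a \<bullet> y a"]
      by (simp add: inner_commute)
  qed
  show ?thesis using *[of a b] *[of b a] by linarith
qed

section \<open>Translation by the period and the energy of a solution\<close>

lemma Hill_solution_shift:
  assumes "Hill_solution A y v" and per: "\<And>t. A (t + c) = A t"
  shows "Hill_solution A (\<lambda>t. y (t + c)) (\<lambda>t. v (t + c))"
  unfolding Hill_solution_def
proof (intro conjI allI impI)
  show "((\<lambda>t. y (t + c)) has_vector_derivative v (t + c)) (at t)" for t
    using assms(1) by (intro has_vector_derivative_shift) (simp add: Hill_solution_def)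
  show "((\<lambda>s. - (A s *v y (s + c))) has_integral v (b + c) - v (a + c)) {a..b}" if "a \<le> b" for a b
  proof -
    have "((\<lambda>s. - (A s *v y s)) has_integral v (b + c) - v (a + c)) {a + c..b + c}"
      using assms(1) that by (auto simp: Hill_solution_def)
    then show ?thesis
      using has_integral_shift_real_ivl_iff[of "\<lambda>s. - (A s *v y s)" "v (b + c) - v (a + c)" "a + c" "b + c" c]
      by (simp add: per)
  qed
qed

lemma Hill_coefficient_shift:
  assumes "Hill_coefficient T A"
  shows "A (t + of_int n * T) = A t"
proof (induction n arbitrary: t rule: int_induct[of _ 0])
  case (step1 i)
  then show ?case using assms[unfolded Hill_coefficient_def]
    by (metis (no_types, lifting) add.assoc distrib_right of_int_1 of_int_add mult_1)
next
  case (step2 i)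
  have "A (t + of_int (i - 1) * T) = A (t + of_int (i - 1) * T + T)"
    using assms by (simp add: Hill_coefficient_def)
  also have "\<dots> = A (t + of_int i * T)" by (simp add: algebra_simps)
  finally show ?case using step2 by simp
qed auto

text \<open>The Wronskian of a solution and its translate by the period is a quadratic form in the
  solution; splitting off the mean \<open>s\<close> of the end values makes all cross terms cancel.\<close>

lemma Hill_wronskian_eq_energy:
  fixes y v :: "real \<Rightarrow> real ^ 'n"
  assumes A: "\<And>a b. A absolutely_integrable_on {a..b}" and sym: "\<And>t. transpose (A t) = A t"
    and sol: "Hill_solution A y v" and "0 \<le> T"
  defines "s \<equiv> (1/2) *\<^sub>R (y 0 + y T)"
  shows "((\<lambda>t. v t \<bullet> v t + (A t *v s) \<bullet> s - (A t *v (y t - s)) \<bullet> (y t - s))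
    has_integral (y T \<bullet> v 0 - v T \<bullet> y 0)) {0..T}"
proof -
  have 1: "((\<lambda>t. v t \<bullet> v t - (A t *v y t) \<bullet> (y t - s)) has_integral
      (v T \<bullet> (y T - s) - v 0 \<bullet> (y 0 - s))) {0..T}"
    using sol \<open>0 \<le> T\<close> Hill_solution_continuous[OF A sol]
    by (intro Hill_solution_by_parts[OF A]) (auto simp: Hill_solution_def intro!: derivative_eq_intros)
  have 2: "((\<lambda>t. - (A t *v y t) \<bullet> s) has_integral (v T - v 0) \<bullet> s) {0..T}"
    using has_integral_linear[of "\<lambda>t. - (A t *v y t)" "v T - v 0" "{0..T}" "\<lambda>x. x \<bullet> s"] sol \<open>0 \<le> T\<close>
    by (auto simp: o_def Hill_solution_def bounded_linear_inner_left)
  have e: "v t \<bullet> v t - (A t *v y t) \<bullet> (y t - s) - (- (A t *v y t) \<bullet> s) =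
      v t \<bullet> v t + (A t *v s) \<bullet> s - (A t *v (y t - s)) \<bullet> (y t - s)" for t
    using symmetric_matrix_inner[OF sym, of t "y t" s]
    by (simp add: inner_simps matrix_vector_mult_diff_distrib inner_commute)
  \<comment> \<open>Because \<open>2 s = y 0 + y T\<close>, the products of \<open>v\<close> and
    \<open>y\<close> at equal times drop out and only the mixed products of the Wronskian
    remain.\<close>
  have "v T \<bullet> (y T - s) - v 0 \<bullet> (y 0 - s) - (v T - v 0) \<bullet> s = y T \<bullet> v 0 - v T \<bullet> y 0"
    by (simp add: s_def inner_simps inner_commute field_simps)
  then show ?thesis using has_integral_diff[OF 1 2] unfolding e by simp
qed

text \<open>This is Cauchy-Schwarz against the constant 1, obtained from the nonnegative integral of
  \<open>(f t - m)^2\<close>, where \<open>m\<close> is the mean of \<open>f\<close>.\<close>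

lemma integral_square_le:
  fixes f :: "real \<Rightarrow> real"
  assumes "continuous_on {0..T} f" "0 < T"
  shows "(integral {0..T} f)\<^sup>2 \<le> T * integral {0..T} (\<lambda>t. (f t)\<^sup>2)"
proof -
  define m where "m = integral {0..T} f / T"
  have i: "(f has_integral m * T) {0..T}" "((\<lambda>t. (f t)\<^sup>2) has_integral integral {0..T} (\<lambda>t. (f t)\<^sup>2)) {0..T}"
    using assms by (auto simp: m_def intro!: integrable_integral integrable_continuous_interval continuous_intros)
  have "((\<lambda>t. (f t)\<^sup>2 - 2 * m * f t + m\<^sup>2) has_integral
     integral {0..T} (\<lambda>t. (f t)\<^sup>2) - 2 * m * (m * T) + T * m\<^sup>2) {0..T}"
    using has_integral_const_real[of "m\<^sup>2" 0 T] assms(2)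
    by (intro has_integral_add has_integral_diff has_integral_mult_right i) (auto simp: mult.commute)
  moreover have "(f t)\<^sup>2 - 2 * m * f t + m\<^sup>2 = (f t - m)\<^sup>2" for t
    by (simp add: power2_eq_square algebra_simps)
  ultimately have "((\<lambda>t. (f t - m)\<^sup>2) has_integral
     integral {0..T} (\<lambda>t. (f t)\<^sup>2) - 2 * m * (m * T) + T * m\<^sup>2) {0..T}" by simp
  then have "0 \<le> integral {0..T} (\<lambda>t. (f t)\<^sup>2) - 2 * m * (m * T) + T * m\<^sup>2"
    by (rule has_integral_nonneg) simp
  then have "T * (m\<^sup>2 * T) \<le> T * integral {0..T} (\<lambda>t. (f t)\<^sup>2)"
    using assms(2) by (intro mult_left_mono) (auto simp: power2_eq_square algebra_simps)
  then show ?thesis using assms(2) by (simp add: m_def power2_eq_square field_simps)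
qed

text \<open>\<open>h t\<close> is half the integral of \<open>v\<close> over \<open>[0, t]\<close> minus half that over \<open>[t, T]\<close>.\<close>

lemma antiperiodic_sup_bound:
  fixes h :: "real \<Rightarrow> 'a::euclidean_space"
  assumes h: "\<And>t. t \<in> {0..T} \<Longrightarrow> (h has_vector_derivative v t) (at t within {0..T})"
    and v: "continuous_on {0..T} v" and T: "0 < T" and ap: "h T = - h 0" and t: "t \<in> {0..T}"
  shows "(norm (h t))\<^sup>2 \<le> T / 4 * integral {0..T} (\<lambda>t. v t \<bullet> v t)"
proof -
  have nv: "(\<lambda>t. norm (v t)) integrable_on {0..T}"
    by (intro integrable_continuous_interval continuous_intros v)
  have le: "norm (h b - h a) \<le> integral {a..b} (\<lambda>t. norm (v t))"
    if ab: "0 \<le> a" "a \<le> b" "b \<le> T" for a b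
  proof -
    have sub: "{a..b} \<subseteq> {0..T}" using ab by auto
    have "(v has_integral (h b - h a)) {a..b}"
      using ab sub by (intro fundamental_theorem_of_calculus)
        (auto intro!: has_vector_derivative_within_subset[OF h])
    then show ?thesis
      using integral_norm_bound_integral[of v "{a..b}" "\<lambda>t. norm (v t)"]
        integrable_subinterval_real[OF nv sub]
      by (auto simp: has_integral_iff)
  qed
  have "h t + h t = (h t - h 0) - (h T - h t)" using ap by simp
  then have "norm (h t + h t) \<le> norm (h t - h 0) + norm (h T - h t)"
    using norm_triangle_ineq4 by metis
  moreover have "norm (h t + h t) = 2 * norm (h t)"
    by (metis norm_scaleR real_norm_def scaleR_2 abs_numeral)
  moreover have "integral {0..t} (\<lambda>t. norm (v t)) + integral {t..T} (\<lambda>t. norm (v t)) =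
      integral {0..T} (\<lambda>t. norm (v t))"
    using Henstock_Kurzweil_Integration.integral_combine[of 0 t T "\<lambda>t. norm (v t)"] nv t by auto
  ultimately have "2 * norm (h t) \<le> integral {0..T} (\<lambda>t. norm (v t))"
    using le[of 0 t] le[of t T] t by auto
  then have "(2 * norm (h t))\<^sup>2 \<le> (integral {0..T} (\<lambda>t. norm (v t)))\<^sup>2"
    by (intro power_mono) auto
  also have "\<dots> \<le> T * integral {0..T} (\<lambda>t. (norm (v t))\<^sup>2)"
    by (intro integral_square_le continuous_intros v T)
  finally show ?thesis by (simp add: power_mult_distrib power2_norm_eq_inner)
qed

text \<open>In the energy form of the Wronskian the lower bound for \<open>A0\<close> acts on the
  constant part \<open>s\<close>, and the upper bound acts on \<open>y - s\<close> through the
  antiperiodic estimate; \<open>\<eta>\<close> is the price for replacing \<open>A0\<close> by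
  \<open>A\<close>. The constant \<open>K\<close> is chosen before the solution, so one
  \<open>K\<close> serves all translates of a solution.\<close>

lemma Hill_solution_bound_on_period:
  fixes A A0 :: "real \<Rightarrow> real ^ 'n ^ 'n"
  assumes A: "\<And>a b. A absolutely_integrable_on {a..b}" and sym: "\<And>t. transpose (A t) = A t"
    and A0: "\<And>a b. A0 absolutely_integrable_on {a..b}"
    and lower: "\<And>t x. \<delta> * (x \<bullet> x) \<le> (A0 t *v x) \<bullet> x"
    and upper: "\<And>t x. (A0 t *v x) \<bullet> x \<le> lam * (x \<bullet> x)"
    and T: "0 < T"
    and \<eta>: "\<eta> = integral {0..T} (\<lambda>t. norm (A t - A0 t))"
    and c1: "0 < T * \<delta> - \<eta>" and c2: "0 < 1 - (lam * T + \<eta>) * (T / 4)"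
  obtains K where "\<And>y v t. Hill_solution A y v \<Longrightarrow> t \<in> {0..T} \<Longrightarrow>
      norm (y t) \<le> K * sqrt (y T \<bullet> v 0 - v T \<bullet> y 0) \<and>
      norm (v t) \<le> K * sqrt (y T \<bullet> v 0 - v T \<bullet> y 0)"
proof -
  \<comment> \<open>These are the coefficients with which \<open>s \<bullet> s\<close> and the
    integral of \<open>v \<bullet> v\<close> survive in the lower bound for the Wronskian.\<close>
  define c1 c2 where "c1 = T * \<delta> - \<eta>" and "c2 = 1 - (lam * T + \<eta>) * (T / 4)"
  \<comment> \<open>The first summand bounds \<open>s\<close>, the second bounds
    \<open>y t - s\<close>.\<close>
  define K where "K = 1 / sqrt c1 + sqrt (T / (4 * c2))"
  define N where "N = integral {0..T} (\<lambda>t. norm (A t))"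
  \<comment> \<open>The mean of \<open>v\<close> over the period is \<open>(y T - y 0) / T\<close>,
    at most \<open>2 * K / T\<close> times \<open>sqrt q\<close>; the deviation of \<open>v\<close>
    from it costs at most \<open>N * K\<close> times \<open>sqrt q\<close>.\<close>
  define K' where "K' = N * K + 2 * K / T"
  have c: "c1 > 0" "c2 > 0" using c1 c2 by (auto simp: c1_def c2_def)
  have K0: "K \<ge> 0" unfolding K_def using c T by auto
  have N0: "N \<ge> 0" unfolding N_def
    by (intro integral_nonneg) (use A in \<open>auto simp: absolutely_integrable_on_def\<close>)
  have K': "K' \<ge> 0" unfolding K'_def using K0 N0 T by auto
  have "norm (y t) \<le> max K K' * sqrt (y T \<bullet> v 0 - v T \<bullet> y 0) \<and>
      norm (v t) \<le> max K K' * sqrt (y T \<bullet> v 0 - v T \<bullet> y 0)"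
    if sol: "Hill_solution A y v" and t: "t \<in> {0..T}" for y v t
  proof -
    define q where "q = y T \<bullet> v 0 - v T \<bullet> y 0"
    define s where "s = (1/2) *\<^sub>R (y 0 + y T)"
    define V where "V = integral {0..T} (\<lambda>t. v t \<bullet> v t)"
    let ?E = "\<lambda>t. norm (A t - A0 t)"
    have cv: "continuous_on S v" and cy: "continuous_on S y" for S
      using Hill_solution_continuous[OF A sol] by auto
    have Ei: "?E integrable_on {0..T}"
      using set_integral_diff(1)[OF A A0, of 0 T] by (auto simp: absolutely_integrable_on_def)
    have Vi: "((\<lambda>t. v t \<bullet> v t) has_integral V) {0..T}"
      unfolding V_def by (intro integrable_integral integrable_continuous_interval continuous_intros cv)
    have hb: "(norm (y t - s))\<^sup>2 \<le> T / 4 * V" if "t \<in> {0..T}" for t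
      unfolding V_def
    proof (rule antiperiodic_sup_bound[OF _ cv T _ that])
      show "((\<lambda>t. y t - s) has_vector_derivative v t) (at t within {0..T})" for t
        using has_vector_derivative_diff[OF has_vector_derivative_at_within has_vector_derivative_const[of s],
          of y "v t" t "{0..T}"] sol
        by (simp add: Hill_solution_def)
      show "y T - s = - (y 0 - s)"
        by (simp add: s_def vec_eq_iff field_simps)
    qed
    have V0: "V \<ge> 0" using Vi by (rule has_integral_nonneg) simp
    have E: "\<bar>(A t *v x) \<bullet> x - (A0 t *v x) \<bullet> x\<bar> \<le> ?E t * (x \<bullet> x)" for t x
    proof -
      have "(A t *v x) \<bullet> x - (A0 t *v x) \<bullet> x = ((A t - A0 t) *v x) \<bullet> x"
        by (simp add: matrix_vector_mult_diff_rdistrib inner_simps)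
      also have "\<bar>\<dots>\<bar> \<le> norm ((A t - A0 t) *v x) * norm x" by (rule Cauchy_Schwarz_ineq2)
      also have "\<dots> \<le> (?E t * norm x) * norm x"
        by (intro mult_right_mono norm_matrix_vector_mult_le) auto
      finally show ?thesis by (simp add: norm_eq_sqrt_inner mult.assoc)
    qed
    \<comment> \<open>The factor \<open>lam + ?E t\<close> must be nonnegative before the bound on
      \<open>norm (y t - s)\<close> can be multiplied by it.\<close>
    have lam0: "0 \<le> lam"
    proof -
      obtain x :: "real ^ 'n" where "x \<bullet> x = 1" using vector_choose_size[of 1] 
        by (metis norm_eq_1 zero_le_one)
      moreover have "\<delta> > 0"
      proof -
        have "\<eta> \<ge> 0" unfolding \<eta> by (rule integral_nonneg[OF Ei]) simp
        then show ?thesis using c1 T by (metis add_0 diff_gt_0_iff_gt le_less_trans less_le_trans zero_less_mult_pos)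
      qed
      ultimately show ?thesis using lower[of x 0] upper[of 0 x] by simp
    qed
    \<comment> \<open>\<open>?b\<close> is a pointwise minorant of the energy density:
      \<open>s\<close> is constant in time and \<open>y t - s\<close> has been replaced by its
      uniform bound, so its integral is explicit.\<close>
    let ?b = "\<lambda>t. v t \<bullet> v t + ((\<delta> - ?E t) * (s \<bullet> s)) - (lam + ?E t) * (T / 4 * V)"
    have "(?b has_integral V + (T * \<delta> - \<eta>) * (s \<bullet> s) - (lam * T + \<eta>) * (T / 4 * V)) {0..T}"
      using has_integral_const_real[of \<delta> 0 T] has_integral_const_real[of lam 0 T] T Ei
      by (intro has_integral_add has_integral_diff has_integral_mult_left Vi)
        (auto simp: \<eta> mult.commute intro: integrable_integral)
    moreover have "((\<lambda>t. v t \<bullet> v t + (A t *v s) \<bullet> s - (A t *v (y t - s)) \<bullet> (y t - s))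
        has_integral q) {0..T}"
      unfolding q_def s_def using Hill_wronskian_eq_energy[OF A sym sol] T by simp
    ultimately have "V + (T * \<delta> - \<eta>) * (s \<bullet> s) - (lam * T + \<eta>) * (T / 4 * V) \<le> q"
    proof (rule has_integral_le)
      fix t assume t: "t \<in> {0..T}"
      have "(\<delta> - ?E t) * (s \<bullet> s) \<le> (A t *v s) \<bullet> s"
        using E[of t s] lower[of s t] by (auto simp: algebra_simps)
      moreover have "(A t *v (y t - s)) \<bullet> (y t - s) \<le> (lam + ?E t) * ((y t - s) \<bullet> (y t - s))"
        using E[of t "y t - s"] upper[of t "y t - s"] unfolding distrib_right by linarith
      moreover have "\<dots> \<le> (lam + ?E t) * (T / 4 * V)"
        using hb[OF t] lam0 by (intro mult_left_mono) (auto simp: power2_norm_eq_inner)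
      ultimately show "?b t \<le> v t \<bullet> v t + (A t *v s) \<bullet> s - (A t *v (y t - s)) \<bullet> (y t - s)"
        by linarith
    qed
    then have q: "c1 * (s \<bullet> s) + c2 * V \<le> q"
      by (simp add: c1_def c2_def algebra_simps)
    have yb: "norm (y t) \<le> K * sqrt q" if "t \<in> {0..T}" for t
    proof -
      have "c1 * (s \<bullet> s) \<le> q" "c2 * V \<le> q"
        using q c V0 by (auto intro: order_trans[rotated])
      then have "s \<bullet> s \<le> q / c1" "V \<le> q / c2" using c by (auto simp: field_simps)
      then have "norm s \<le> sqrt (q / c1)" "T / 4 * V \<le> T / (4 * c2) * q"
        using T mult_left_mono[of V "q / c2" "T / 4"] by (auto simp: norm_eq_sqrt_inner)
      moreover have "norm (y t - s) \<le> sqrt (T / 4 * V)"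
        using hb[OF that] by (simp add: real_le_rsqrt)
      ultimately have "norm s + norm (y t - s) \<le> sqrt (q / c1) + sqrt (T / (4 * c2) * q)"
        using real_sqrt_le_mono by (meson add_mono order_trans)
      also have "\<dots> = K * sqrt q"
        unfolding K_def real_sqrt_mult real_sqrt_divide by (simp add: algebra_simps)
      finally show ?thesis using norm_triangle_sub[of "y t" s] by linarith
    qed
    have Ayb: "norm (v b - v a) \<le> N * (K * sqrt q)" if ab: "0 \<le> a" "a \<le> b" "b \<le> T" for a b
    proof -
      have I: "((\<lambda>s. - (A s *v y s)) has_integral (v b - v a)) {a..b}"
        using sol ab by (auto simp: Hill_solution_def)
      have J: "(\<lambda>s. norm (A s)) integrable_on {a..b}" for a b
        using A by (auto simp: absolutely_integrable_on_def)
      have "norm (v b - v a) \<le> integral {a..b} (\<lambda>s. norm (A s) * (K * sqrt q))"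
        unfolding integral_unique[OF I, symmetric]
      proof (intro integral_norm_bound_integral has_integral_integrable[OF I] integrable_on_mult_left J)
        show "norm (- (A x *v y x)) \<le> norm (A x) * (K * sqrt q)" if "x \<in> {a..b}" for x
          using order_trans[OF norm_matrix_vector_mult_le[of "A x" "y x"] mult_left_mono[OF yb[of x]]] that ab
          by auto
      qed
      also have "\<dots> = integral {a..b} (\<lambda>s. norm (A s)) * (K * sqrt q)"
        by simp
      also have "\<dots> \<le> N * (K * sqrt q)"
        unfolding N_def using ab J order_trans[OF norm_ge_zero yb[of 0]] T
        by (intro mult_right_mono integral_subset_le) auto
      finally show ?thesis .
    qed
    have vb: "norm (v t) \<le> K' * sqrt q"
    proof -
      have "(v has_integral (y T - y 0)) {0..T}"
        using sol T by (intro fundamental_theorem_of_calculus)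
          (auto simp: Hill_solution_def intro: has_vector_derivative_at_within)
      \<comment> \<open>Comparing \<open>v t\<close> with its mean over the period turns the bound
        on increments of \<open>v\<close> into a bound on \<open>v t\<close> itself.\<close>
      then have "((\<lambda>\<tau>. v t - v \<tau>) has_integral (T *\<^sub>R v t - (y T - y 0))) {0..T}"
        using has_integral_const_real[of "v t" 0 T] T by (intro has_integral_diff) auto
      then have "norm (T *\<^sub>R v t - (y T - y 0)) \<le> N * (K * sqrt q) * T"
      proof -
        have "norm (v t - v \<tau>) \<le> N * (K * sqrt q)" if "\<tau> \<in> {0..T}" for \<tau>
          using Ayb[of \<tau> t] Ayb[of t \<tau>] that t by (cases "\<tau> \<le> t") (auto simp: norm_minus_commute)
        moreover have "0 \<le> N * (K * sqrt q)"
          using N0 order_trans[OF norm_ge_zero yb[of 0]] T by simp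
        ultimately have "norm (T *\<^sub>R v t - (y T - y 0)) \<le> N * (K * sqrt q) * measure lborel {0..T}"
          using \<open>((\<lambda>\<tau>. v t - v \<tau>) has_integral _) _\<close>
          by (intro has_integral_bound_real[where f = "\<lambda>\<tau>. v t - v \<tau>" and S = "{}"]) auto
        then show ?thesis using T by simp
      qed
      moreover have "norm (T *\<^sub>R v t) \<le> norm (T *\<^sub>R v t - (y T - y 0)) + (norm (y T) + norm (y 0))"
        by (smt (verit) norm_triangle_ineq4 norm_triangle_sub)
      moreover have "norm (y T) + norm (y 0) \<le> 2 * (K * sqrt q)"
        using yb[of 0] yb[of T] T by auto
      ultimately have "T * norm (v t) \<le> N * (K * sqrt q) * T + 2 * (K * sqrt q)"
        using T by simp
      then have "norm (v t) \<le> (N * (K * sqrt q) * T + 2 * (K * sqrt q)) / T"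
        using T by (simp add: field_simps)
      also have "\<dots> = K' * sqrt q" using T by (simp add: K'_def field_simps)
      finally show ?thesis .
    qed
    have "0 \<le> c1 * (s \<bullet> s) + c2 * V" using c V0 by auto
    then have "0 \<le> sqrt q" using q by auto
    then have "K * sqrt q \<le> max K K' * sqrt q" "K' * sqrt q \<le> max K K' * sqrt q"
      by (auto intro: mult_right_mono)
    then show ?thesis using yb[OF t] vb unfolding q_def by linarith
  qed
  then show ?thesis by (rule that)
qed

text \<open>On one period the solution is controlled by its Wronskian with its own translate. That
  number is the same on every period, so the control is uniform on the line.\<close>

theorem strongly_stable_criterion:
  fixes A0 :: "real \<Rightarrow> real ^ 'n ^ 'n"
  assumes A0: "Hill_coefficient T A0" and T: "0 < T" and \<delta>: "0 < \<delta>"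
    and lower: "\<And>t x. \<delta> * (x \<bullet> x) \<le> (A0 t *v x) \<bullet> x"
    and upper: "\<And>t x. (A0 t *v x) \<bullet> x \<le> lam * (x \<bullet> x)"
    and lam: "lam * T\<^sup>2 < 4"
  shows "strongly_stable T A0"
proof -
  \<comment> \<open>The two entries are the thresholds for \<open>\<eta>\<close> below which the
    coefficients of \<open>s \<bullet> s\<close> and of the velocity integral stay positive; the
    second is positive by \<open>lam * T^2 < 4\<close>.\<close>
  define \<epsilon> where "\<epsilon> = min (T * \<delta>) (4 / T - lam * T)"
  have \<epsilon>: "\<epsilon> > 0"
    using T \<delta> lam by (simp add: \<epsilon>_def field_simps power2_eq_square)
  have "Hill_stable A" if A: "Hill_coefficient T A"
    and close: "integral {0..T} (\<lambda>t. norm (A t - A0 t)) < \<epsilon>" for A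
  proof -
    define \<eta> where "\<eta> = integral {0..T} (\<lambda>t. norm (A t - A0 t))"
    have sym: "transpose (A t) = A t" and Ai: "A absolutely_integrable_on {a..b}"
      and A0i: "A0 absolutely_integrable_on {a..b}" for t a b
      using A A0 by (auto simp: Hill_coefficient_def)
    have "0 < T * \<delta> - \<eta>" using close by (simp add: \<epsilon>_def \<eta>_def)
    moreover have "\<eta> < 4 / T - lam * T" using close by (simp add: \<epsilon>_def \<eta>_def)
    then have "0 < 1 - (lam * T + \<eta>) * (T / 4)"
      using T by (simp add: field_simps)
    ultimately obtain K where K: "\<And>y v t. Hill_solution A y v \<Longrightarrow> t \<in> {0..T} \<Longrightarrow>
      norm (y t) \<le> K * sqrt (y T \<bullet> v 0 - v T \<bullet> y 0) \<and>
      norm (v t) \<le> K * sqrt (y T \<bullet> v 0 - v T \<bullet> y 0)"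
      using Hill_solution_bound_on_period[OF Ai sym A0i lower upper T \<eta>_def] by metis
    show ?thesis
      unfolding Hill_stable_def
    proof (intro allI impI)
      fix y v assume sol: "Hill_solution A y v"
      have shift: "Hill_solution A (\<lambda>s. y (s + of_int n * T)) (\<lambda>s. v (s + of_int n * T))" for n
        by (rule Hill_solution_shift[OF sol Hill_coefficient_shift[OF A]])
      have "norm (y t) \<le> K * sqrt (y T \<bullet> v 0 - v T \<bullet> y 0) \<and>
        norm (v t) \<le> K * sqrt (y T \<bullet> v 0 - v T \<bullet> y 0)" for t
      proof -
        define n where "n = \<lfloor>t / T\<rfloor>"
        define \<tau> where "\<tau> = t - of_int n * T"
        have "of_int n \<le> t / T" "t / T < of_int n + 1" by (auto simp: n_def)
        then have "\<tau> \<in> {0..T}" using T by (auto simp: \<tau>_def field_simps)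
        \<comment> \<open>The Wronskian of \<open>y\<close> and its translate by one period is
          evaluated at the times \<open>n T\<close> and 0.\<close>
        moreover have "y (T + of_int n * T) \<bullet> v (0 + of_int n * T) - v (T + of_int n * T) \<bullet> y (0 + of_int n * T)
            = y T \<bullet> v 0 - v T \<bullet> y 0"
          using Hill_wronskian_constant[OF Ai sym sol shift[of 1], of "of_int n * T" 0]
          by (simp add: add.commute)
        ultimately show ?thesis
          using K[OF shift[of n], of \<tau>] by (simp add: \<tau>_def)
      qed
      then show "bounded (range y) \<and> bounded (range v)"
        by (auto simp: bounded_iff)
    qed
  qed
  with A0 \<epsilon> show ?thesis unfolding strongly_stable_def by blast
qed

section \<open>The Kepler orbit\<close>

lemma eccentric_anomaly_0 [simp]: "0 \<le> e \<Longrightarrow> e < 1 \<Longrightarrow> eccentric_anomaly e 0 = 0"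
  by (rule eccentric_anomaly_unique) auto

text \<open>Symmetries come from uniqueness in Kepler's equation: the expected value is checked to
  be a root.\<close>

lemma eccentric_anomaly_minus:
  assumes "0 \<le> e" "e < 1"
  shows "eccentric_anomaly e (- t) = - eccentric_anomaly e t"
  by (rule eccentric_anomaly_unique[OF assms]) (use eccentric_anomaly_eq[OF assms, of t] in simp)

lemma eccentric_anomaly_periodic:
  assumes "0 \<le> e" "e < 1"
  shows "eccentric_anomaly e (t + 2 * pi) = eccentric_anomaly e t + 2 * pi"
  by (rule eccentric_anomaly_unique[OF assms]) (use eccentric_anomaly_eq[OF assms, of t] in simp)

lemma orbital_radius_minus:
  assumes "0 \<le> e" "e < 1"
  shows "orbital_radius e (- t) = orbital_radius e t"
  by (simp add: orbital_radius_def eccentric_anomaly_minus[OF assms])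

lemma orbital_radius_periodic:
  assumes "0 \<le> e" "e < 1"
  shows "orbital_radius e (t + 2 * pi) = orbital_radius e t"
  by (simp add: orbital_radius_def eccentric_anomaly_periodic[OF assms])

text \<open>The lower bound gives the powers of \<open>1 - e\<close> in the hypotheses; the upper
  bound 2 later keeps \<open>(1 / r) ^ 3\<close> above \<open>1 / 8\<close> uniformly in
  \<open>e\<close>.\<close>

lemma orbital_radius_bounds:
  assumes "0 \<le> e" "e < 1"
  shows "1 - e \<le> orbital_radius e t" and "orbital_radius e t \<le> 2" and "0 < orbital_radius e t"
proof -
  have "\<bar>e * cos (eccentric_anomaly e t)\<bar> \<le> e"
    using assms by (simp add: abs_mult mult_left_le)
  then show "1 - e \<le> orbital_radius e t" "orbital_radius e t \<le> 2" "0 < orbital_radius e t"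
    using assms by (auto simp: orbital_radius_def)
qed

text \<open>The inverse function rule applies to \<open>u - e * sin u\<close>, whose derivative at
  the eccentric anomaly is the orbital radius.\<close>

lemma DERIV_eccentric_anomaly:
  assumes e: "0 \<le> e" "e < 1"
  shows "(eccentric_anomaly e has_real_derivative 1 / orbital_radius e t) (at t)"
proof -
  have "(eccentric_anomaly e has_real_derivative inverse (orbital_radius e t)) (at t)"
  proof (rule DERIV_inverse_function[where a = "t - 1" and b = "t + 1" and f = "\<lambda>u. u - e * sin u"])
    show "((\<lambda>u. u - e * sin u) has_real_derivative orbital_radius e t) (at (eccentric_anomaly e t))"
      unfolding orbital_radius_def by (auto intro!: derivative_eq_intros)
    show "isCont (eccentric_anomaly e) t"
      using continuous_eccentric_anomaly[OF e] by (simp add: continuous_on_eq_continuous_at)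
  qed (use orbital_radius_bounds(3)[OF e, of t] eccentric_anomaly_eq[OF e] in auto)
  then show ?thesis by (simp add: inverse_eq_divide)
qed

lemma DERIV_orbital_radius:
  assumes e: "0 \<le> e" "e < 1"
  shows "(orbital_radius e has_real_derivative e * sin (eccentric_anomaly e t) / orbital_radius e t) (at t)"
proof -
  have "orbital_radius e = (\<lambda>t. 1 - e * cos (eccentric_anomaly e t))"
    by (simp add: orbital_radius_def fun_eq_iff)
  then show ?thesis
    by (auto intro!: derivative_eq_intros DERIV_eccentric_anomaly[OF e])
qed

lemma continuous_orbital_radius:
  assumes e: "0 \<le> e" "e < 1"
  shows "continuous_on S (orbital_radius e)"
  by (meson DERIV_orbital_radius[OF e] DERIV_isCont continuous_at_imp_continuous_on)

text \<open>The definite description is not differentiated directly. An antiderivative of the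
  expected angular velocity (conservation of angular momentum) is shown to be a true anomaly, and
  uniqueness identifies the two.\<close>

lemma DERIV_true_anomaly:
  assumes e: "0 \<le> e" "e < 1"
  shows "(true_anomaly e has_real_derivative sqrt (1 - e\<^sup>2) / (orbital_radius e t)\<^sup>2) (at t)"
proof -
  let ?E = "eccentric_anomaly e" and ?r = "orbital_radius e"
  define b where "b = sqrt (1 - e\<^sup>2)"
  have b2: "b\<^sup>2 = 1 - e\<^sup>2" using e by (simp add: b_def power_le_one)
  have rne: "?r t \<noteq> 0" for t using orbital_radius_bounds(3)[OF e, of t] by simp
  have cg: "continuous_on S (\<lambda>t. b / (?r t)\<^sup>2)" for S
    using rne by (intro continuous_intros continuous_orbital_radius[OF e]) auto
  obtain g where g: "\<And>t. (g has_real_derivative b / (?r t)\<^sup>2) (at t)"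
    using einterval_antiderivative[of "-\<infinity>" "\<infinity>" "\<lambda>t. b / (?r t)\<^sup>2"] cg[of UNIV]
    by (auto simp: continuous_on_eq_continuous_at has_real_derivative_iff_has_vector_derivative)
  define f where "f t = g t - g 0" for t
  have f: "(f has_real_derivative b / (?r t)\<^sup>2) (at t)" for t
    unfolding f_def by (auto intro!: derivative_eq_intros g)
  have "is_true_anomaly e f"
    unfolding is_true_anomaly_def
  proof (intro conjI allI)
    show "continuous_on UNIV f"
      by (meson f DERIV_isCont continuous_at_imp_continuous_on)
    show "f 0 = 0" by (simp add: f_def)
    fix t
    \<comment> \<open>\<open>X + \<i> Y\<close> is \<open>exp (- \<i> f)\<close> times the normalised position, to be shown constantly 1.\<close>
    define X where "X t = ((cos (?E t) - e) * cos (f t) + b * sin (?E t) * sin (f t)) / ?r t" for t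
    define Y where "Y t = (b * sin (?E t) * cos (f t) - (cos (?E t) - e) * sin (f t)) / ?r t" for t
    \<comment> \<open>\<open>k1\<close> and \<open>k2\<close> are the two identities that annihilate
      the coefficients of \<open>cos (f t)\<close> and \<open>sin (f t)\<close> in the derivatives
      of both \<open>X\<close> and \<open>Y\<close>.\<close>
    have k1: "- sin (?E t) * ?r t = (cos (?E t) - e) * (e * sin (?E t)) - b\<^sup>2 * sin (?E t)" for t
      unfolding b2 by (simp add: orbital_radius_def power2_eq_square algebra_simps)
    have k2: "b * cos (?E t) * ?r t = b * sin (?E t) * (e * sin (?E t)) + b * (cos (?E t) - e)" for t
    proof -
      have "b * sin (?E t) * (e * sin (?E t)) = b * e * (sin (?E t))\<^sup>2"
        by (simp add: power2_eq_square)
      also have "\<dots> = b * e * (1 - (cos (?E t))\<^sup>2)" by (simp add: sin_squared_eq)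
      finally show ?thesis by (simp add: orbital_radius_def power2_eq_square algebra_simps)
    qed
    have "(X has_real_derivative 0) (at t)" for t
    proof -
      have D: "(X has_real_derivative
         (((- sin (?E t) / ?r t) * cos (f t) + (cos (?E t) - e) * (- sin (f t) * b / (?r t)\<^sup>2)
          + (b * (cos (?E t) / ?r t) * sin (f t) + b * sin (?E t) * (cos (f t) * b / (?r t)\<^sup>2))) * ?r t
          - ((cos (?E t) - e) * cos (f t) + b * sin (?E t) * sin (f t)) * (e * sin (?E t) / ?r t)) / (?r t * ?r t)) (at t)"
        (is "(_ has_real_derivative ?D) _")
        unfolding X_def using rne
        by (auto intro!: derivative_eq_intros DERIV_orbital_radius[OF e] DERIV_eccentric_anomaly[OF e] f
            simp: algebra_simps add_divide_distrib diff_divide_distrib)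
      have "?D = ((- sin (?E t) * ?r t - (cos (?E t) - e) * (e * sin (?E t)) + b\<^sup>2 * sin (?E t)) * cos (f t)
          + (b * cos (?E t) * ?r t - b * sin (?E t) * (e * sin (?E t)) - b * (cos (?E t) - e)) * sin (f t)) / (?r t) ^ 3"
        using rne[of t] by (simp add: field_simps power2_eq_square power3_eq_cube)
      also have "\<dots> = 0" unfolding k1 k2 by simp
      finally show ?thesis by (rule DERIV_cong[OF D])
    qed
    then have X: "X t = 1"
      using DERIV_isconst_all[of X t 0] e by (simp add: X_def f_def orbital_radius_def)
    have "(Y has_real_derivative 0) (at t)" for t
    proof -
      have D: "(Y has_real_derivative
         ((b * (cos (?E t) / ?r t) * cos (f t) + b * sin (?E t) * (- sin (f t) * b / (?r t)\<^sup>2)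
          - ((- sin (?E t) / ?r t) * sin (f t) + (cos (?E t) - e) * (cos (f t) * b / (?r t)\<^sup>2))) * ?r t
          - (b * sin (?E t) * cos (f t) - (cos (?E t) - e) * sin (f t)) * (e * sin (?E t) / ?r t)) / (?r t * ?r t)) (at t)"
        (is "(_ has_real_derivative ?D) _")
        unfolding Y_def using rne
        by (auto intro!: derivative_eq_intros DERIV_orbital_radius[OF e] DERIV_eccentric_anomaly[OF e] f
            simp: algebra_simps add_divide_distrib diff_divide_distrib)
      have "?D = ((b * cos (?E t) * ?r t - b * sin (?E t) * (e * sin (?E t)) - b * (cos (?E t) - e)) * cos (f t)
         - (- sin (?E t) * ?r t - (cos (?E t) - e) * (e * sin (?E t)) + b\<^sup>2 * sin (?E t)) * sin (f t)) / (?r t) ^ 3"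
        using rne[of t] by (simp add: field_simps power2_eq_square power3_eq_cube)
      also have "\<dots> = 0" unfolding k1 k2 by simp
      finally show ?thesis by (rule DERIV_cong[OF D])
    qed
    then have Y: "Y t = 0"
      using DERIV_isconst_all[of Y t 0] e by (simp add: Y_def f_def)
    have p: "(cos (f t))\<^sup>2 + (sin (f t))\<^sup>2 = 1" by simp
    have eqX: "(cos (?E t) - e) * cos (f t) + b * sin (?E t) * sin (f t) = ?r t"
      and eqY: "b * sin (?E t) * cos (f t) - (cos (?E t) - e) * sin (f t) = 0"
      using X Y rne[of t] by (auto simp: X_def Y_def)
    \<comment> \<open>This undoes the rotation by \<open>- f\<close>: the system for the position is
      inverted by means of \<open>c^2 + s^2 = 1\<close>.\<close>
    have solve: "r * c = x \<and> r * s = y"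
      if "x * c + y * s = r" "y * c - x * s = 0" "c\<^sup>2 + s\<^sup>2 = 1" for x y c s r :: real
    proof -
      have "r * c = x * c\<^sup>2 + (y * c) * s" "r * s = (x * s) * c + y * s\<^sup>2"
        by (simp_all add: that(1)[symmetric] power2_eq_square algebra_simps)
      moreover have "y * c = x * s" using that(2) by simp
      ultimately have "r * c = x * (c\<^sup>2 + s\<^sup>2)" "r * s = y * (c\<^sup>2 + s\<^sup>2)"
        by (simp_all add: power2_eq_square algebra_simps flip: \<open>y * c = x * s\<close>)
      then show ?thesis using that(3) by simp
    qed
    have "?r t * cos (f t) = cos (?E t) - e \<and> ?r t * sin (f t) = b * sin (?E t)"
      by (rule solve[OF eqX eqY p])
    then show "complex_of_real (?r t) * exp (\<i> * complex_of_real (f t)) =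
      Complex (cos (?E t) - e) (sqrt (1 - e\<^sup>2) * sin (?E t))"
      by (simp add: complex_eq_iff b_def flip: cis_conv_exp)
  qed
  then have "true_anomaly e = f"
    unfolding true_anomaly_def using true_anomaly_ex1[OF e] by (metis the1_equality)
  then show ?thesis using f by (simp add: b_def)
qed

lemma deriv2_true_anomaly:
  assumes e: "0 \<le> e" "e < 1"
  shows "deriv (deriv (true_anomaly e)) t =
    - 2 * e * sqrt (1 - e\<^sup>2) * sin (eccentric_anomaly e t) / orbital_radius e t ^ 4"
proof -
  have "deriv (true_anomaly e) = (\<lambda>t. sqrt (1 - e\<^sup>2) / (orbital_radius e t)\<^sup>2)"
    using DERIV_true_anomaly[OF e] DERIV_imp_deriv by blast
  moreover have "((\<lambda>t. sqrt (1 - e\<^sup>2) / (orbital_radius e t)\<^sup>2) has_real_derivative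
    - 2 * e * sqrt (1 - e\<^sup>2) * sin (eccentric_anomaly e t) / orbital_radius e t ^ 4) (at t)"
    using orbital_radius_bounds(3)[OF e, of t]
    by (auto intro!: derivative_eq_intros DERIV_orbital_radius[OF e]
        simp: field_simps power2_eq_square power4_eq_xxxx)
  ultimately show ?thesis using DERIV_imp_deriv by metis
qed

lemma deriv2_true_anomaly_minus:
  assumes "0 \<le> e" "e < 1"
  shows "deriv (deriv (true_anomaly e)) (- t) = - deriv (deriv (true_anomaly e)) t"
  by (simp add: deriv2_true_anomaly[OF assms] eccentric_anomaly_minus[OF assms]
      orbital_radius_minus[OF assms])

lemma deriv2_true_anomaly_periodic:
  assumes "0 \<le> e" "e < 1"
  shows "deriv (deriv (true_anomaly e)) (t + 2 * pi) = deriv (deriv (true_anomaly e)) t"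
  by (simp add: deriv2_true_anomaly[OF assms] eccentric_anomaly_periodic[OF assms]
      orbital_radius_periodic[OF assms])

lemma continuous_deriv2_true_anomaly:
  assumes e: "0 \<le> e" "e < 1"
  shows "continuous_on S (deriv (deriv (true_anomaly e)))"
proof -
  have "continuous_on S (\<lambda>t. - 2 * e * sqrt (1 - e\<^sup>2) * sin (eccentric_anomaly e t) / orbital_radius e t ^ 4)"
    using orbital_radius_bounds(3)[OF e]
    by (intro continuous_intros continuous_orbital_radius[OF e]
        continuous_on_subset[OF continuous_eccentric_anomaly[OF e]])
      (auto simp: less_imp_neq[symmetric])
  then show ?thesis by (simp add: deriv2_true_anomaly[OF e] fun_eq_iff cong: continuous_on_cong)
qed

text \<open>Doubled, as in the force, this is the last term of \<open>M\<close>.\<close>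

lemma deriv2_true_anomaly_bound:
  assumes e: "0 \<le> e" "e < 1"
  shows "\<bar>deriv (deriv (true_anomaly e)) t\<bar> \<le> 2 * e * sqrt (1 - e\<^sup>2) / (1 - e) ^ 4"
proof -
  have "\<bar>2 * e * sqrt (1 - e\<^sup>2) * sin (eccentric_anomaly e t)\<bar> \<le> 2 * e * sqrt (1 - e\<^sup>2)"
    using e by (simp add: abs_mult mult_left_le power_le_one)
  moreover have "(1 - e) ^ 4 \<le> orbital_radius e t ^ 4"
    using orbital_radius_bounds[OF e, of t] e by (intro power_mono) auto
  ultimately have "\<bar>2 * e * sqrt (1 - e\<^sup>2) * sin (eccentric_anomaly e t)\<bar> / orbital_radius e t ^ 4
      \<le> 2 * e * sqrt (1 - e\<^sup>2) / (1 - e) ^ 4"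
    using e by (intro frac_le) (auto simp: power_le_one)
  then show ?thesis
    using orbital_radius_bounds(3)[OF e, of t] by (simp add: deriv2_true_anomaly[OF e] abs_mult)
qed

section \<open>Odd periodic solutions\<close>

definition odd_periodic :: "(real \<Rightarrow> 'a::real_vector) \<Rightarrow> bool" where
  "odd_periodic f \<longleftrightarrow> (\<forall>t. f (- t) = - f t) \<and> (\<forall>t. f (t + 2 * pi) = f t)"

text \<open>At \<open>pi\<close> the two symmetries combine to
  \<open>f pi = f (- pi) = - f pi\<close>. This is how the Dirichlet conditions enter.\<close>

lemma odd_periodic_zero:
  assumes "odd_periodic f"
  shows "f 0 = 0" and "f pi = 0"
proof -
  have self: "x = - x \<Longrightarrow> x = 0" for x :: 'a
    by (metis add.right_inverse scaleR_2 scaleR_eq_0_iff zero_neq_numeral)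
  show "f 0 = 0" using assms unfolding odd_periodic_def by (metis minus_zero self)
  have "f pi = f (- pi)" using assms unfolding odd_periodic_def
    by (metis add.commute minus_add_cancel mult_2)
  then show "f pi = 0" using assms unfolding odd_periodic_def by (metis self)
qed

lemma odd_periodic_reduce:
  fixes f :: "real \<Rightarrow> 'a::real_normed_vector"
  assumes f: "odd_periodic f" and P: "\<And>t. t \<in> {0..pi} \<Longrightarrow> norm (f t) \<le> B"
  shows "norm (f t) \<le> B"
proof -
  have per: "f (t + of_int n * (2 * pi)) = f t" for n t
  proof (induction n arbitrary: t rule: int_induct[of _ 0])
    case (step1 i)
    have "f (t + of_int (i + 1) * (2 * pi)) = f ((t + of_int i * (2 * pi)) + 2 * pi)"
      by (simp add: algebra_simps)
    then show ?case using f step1 by (simp add: odd_periodic_def)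
  next
    case (step2 i)
    have "f (t + of_int (i - 1) * (2 * pi)) = f (t + of_int (i - 1) * (2 * pi) + 2 * pi)"
      using f by (simp add: odd_periodic_def)
    also have "\<dots> = f (t + of_int i * (2 * pi))" by (simp add: algebra_simps)
    finally show ?case using step2 by simp
  qed simp
  \<comment> \<open>Adding \<open>pi\<close> before rounding down moves the remainder into
    \<open>[- pi, pi]\<close>, where reflection leads back to \<open>[0, pi]\<close>.\<close>
  define n where "n = \<lfloor>(t + pi) / (2 * pi)\<rfloor>"
  define \<tau> where "\<tau> = t - of_int n * (2 * pi)"
  have "of_int n \<le> (t + pi) / (2 * pi)" "(t + pi) / (2 * pi) < of_int n + 1" by (auto simp: n_def)
  then have \<tau>: "- pi \<le> \<tau>" "\<tau> \<le> pi" by (auto simp: \<tau>_def field_simps)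
  have "f t = f \<tau>" using per[of \<tau> n] by (simp add: \<tau>_def)
  moreover have "norm (f \<tau>) \<le> B"
  proof (cases "0 \<le> \<tau>")
    case True
    then show ?thesis using P \<tau> by simp
  next
    case False
    have "f \<tau> = - f (- \<tau>)" using f by (simp add: odd_periodic_def)
    then show ?thesis using P[of "- \<tau>"] \<tau> False by simp
  qed
  ultimately show ?thesis by simp
qed

text \<open>As \<open>v\<close> vanishes at 0 and \<open>pi\<close>, its derivative \<open>w\<close>
  has mean zero on \<open>[0, pi]\<close>. Values of \<open>w\<close> there differ by at most
  \<open>pi * k\<close>, so \<open>w\<close> is bounded by \<open>pi * k\<close>; integrating from 0
  gives the second factor \<open>pi\<close>.\<close>

lemma odd_periodic_bound:
  fixes v w g :: "real \<Rightarrow> 'a::real_normed_vector"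
  assumes v: "\<And>t. (v has_vector_derivative w t) (at t)"
    and w: "\<And>t. (w has_vector_derivative g t) (at t)"
    and op: "odd_periodic v" and g: "\<And>t. norm (g t) \<le> k"
  shows "norm (v t) \<le> pi\<^sup>2 * k"
proof (rule odd_periodic_reduce[OF op])
  have k: "0 \<le> k" using g[of 0] norm_ge_zero order_trans by blast
  have mvt: "norm (f b - f a) \<le> B * \<bar>b - a\<bar>"
    if f: "\<And>t. (f has_vector_derivative D t) (at t)" and "\<And>t. t \<in> {0..pi} \<Longrightarrow> norm (D t) \<le> B"
      and "a \<in> {0..pi}" "b \<in> {0..pi}" for f D :: "real \<Rightarrow> 'a" and a b B
    using differentiable_bound[of "{0..pi}" f "\<lambda>t d. d *\<^sub>R D t" B b a] that
      has_vector_derivative_at_within[OF f]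
    by (auto simp: has_vector_derivative_def onorm_scaleR_left bounded_linear_ident onorm_id)
  have wb: "norm (w t) \<le> pi * k" if t: "t \<in> {0..pi}" for t
  proof -
    have "norm (w t - w s) \<le> pi * k" if s: "s \<in> {0..pi}" for s
    proof -
      have "norm (w t - w s) \<le> k * \<bar>t - s\<bar>" using mvt[OF w g] s t by simp
      also have "\<dots> \<le> k * pi" using s t k by (intro mult_left_mono) auto
      finally show ?thesis by (simp add: mult.commute)
    qed
    \<comment> \<open>The increment of this function over \<open>[0, pi]\<close> is
      \<open>pi *\<^sub>R w t\<close>, so the mean value inequality applied to it uses the vanishing
      mean of \<open>w\<close>.\<close>
    moreover have "((\<lambda>s. s *\<^sub>R w t - v s) has_vector_derivative w t - w s) (at s)" for s
      by (auto intro!: derivative_eq_intros v)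
    ultimately have "norm ((pi *\<^sub>R w t - v pi) - (0 *\<^sub>R w t - v 0)) \<le> (pi * k) * \<bar>pi - 0\<bar>"
      by (intro mvt[of "\<lambda>s. s *\<^sub>R w t - v s" "\<lambda>s. w t - w s"]) auto
    then show ?thesis using odd_periodic_zero[OF op] by (simp add: mult.commute)
  qed
  show "norm (v t) \<le> pi\<^sup>2 * k" if t: "t \<in> {0..pi}" for t
  proof -
    have "norm (v t - v 0) \<le> (pi * k) * \<bar>t - 0\<bar>" using t by (intro mvt[OF v wb]) auto
    also have "\<dots> \<le> (pi * k) * pi" using t k by (intro mult_left_mono) auto
    finally show ?thesis using odd_periodic_zero[OF op] by (simp add: power2_eq_square mult_ac)
  qed
qed

text \<open>Any antiderivative of \<open>g\<close> is even and periodic. The next one becomes odd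
  once it vanishes at 0, and periodic once its mean slope \<open>c\<close> is removed.\<close>

lemma odd_periodic_second_antiderivative:
  fixes g :: "real \<Rightarrow> 'a::euclidean_space"
  assumes cont: "continuous_on UNIV g" and g: "odd_periodic g"
  obtains v w where "\<And>t. (v has_vector_derivative w t) (at t)"
    "\<And>t. (w has_vector_derivative g t) (at t)" "odd_periodic v"
proof -
  obtain G where G: "\<And>t. (G has_vector_derivative g t) (at t)"
    using continuous_has_antiderivative[OF cont] by blast
  have Geven: "G (- t) = G t" for t
  proof -
    have "((\<lambda>t. G t - G (- t)) has_vector_derivative g t - - g (- t)) (at t)" for t
      by (intro has_vector_derivative_diff has_vector_derivative_reflect G)
    then show ?thesis
      using vector_derivative_zero_imp_eq[of "\<lambda>t. G t - G (- t)" t 0] g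
      by (auto simp: odd_periodic_def)
  qed
  have Gper: "G (t + 2 * pi) = G t" for t
  proof -
    have "((\<lambda>t. G (t + 2 * pi) - G t) has_vector_derivative g (t + 2 * pi) - g t) (at t)" for t
      by (intro has_vector_derivative_diff has_vector_derivative_shift G)
    then show ?thesis
      \<comment> \<open>The constant difference is evaluated at \<open>- pi\<close>, where it is
        \<open>G pi - G (- pi) = 0\<close> because \<open>G\<close> is even.\<close>
      using vector_derivative_zero_imp_eq[of "\<lambda>t. G (t + 2 * pi) - G t" t "- pi"] g Geven[of pi]
      by (auto simp: odd_periodic_def)
  qed
  obtain H where H: "\<And>t. (H has_vector_derivative G t) (at t)"
    using continuous_has_antiderivative[OF has_vector_derivative_imp_continuous_on[OF G]] by blast
  define c where "c = (1 / (2 * pi)) *\<^sub>R (H (2 * pi) - H 0)"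
  define v where "v t = H t - H 0 - t *\<^sub>R c" for t
  have v: "(v has_vector_derivative G t - c) (at t)" for t
    unfolding v_def by (auto intro!: derivative_eq_intros H)
  have "v (- t) = - v t" for t
  proof -
    have "((\<lambda>t. v t + v (- t)) has_vector_derivative (G t - c) + - (G (- t) - c)) (at t)" for t
      by (intro has_vector_derivative_add has_vector_derivative_reflect v)
    then have "v t + v (- t) = v 0 + v (- 0)"
      by (intro vector_derivative_zero_imp_eq[of "\<lambda>t. v t + v (- t)"]) (simp add: Geven)
    then show ?thesis by (simp add: v_def[of 0] add_eq_0_iff)
  qed
  moreover have "v (t + 2 * pi) = v t" for t
  proof -
    have "((\<lambda>t. v (t + 2 * pi) - v t) has_vector_derivative (G (t + 2 * pi) - c) - (G t - c)) (at t)" for t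
      by (intro has_vector_derivative_diff has_vector_derivative_shift v)
    then have "v (t + 2 * pi) - v t = v (0 + 2 * pi) - v 0"
      by (intro vector_derivative_zero_imp_eq[of "\<lambda>t. v (t + 2 * pi) - v t"]) (simp add: Gper)
    then show ?thesis by (simp add: v_def[of 0] v_def[of "2 * pi"] c_def)
  qed
  moreover have "((\<lambda>t. G t - c) has_vector_derivative g t) (at t)" for t
    by (auto intro!: derivative_eq_intros G)
  ultimately show thesis using v by (intro that[of v "\<lambda>t. G t - c"]) (auto simp: odd_periodic_def)
qed

section \<open>Odd periodic solutions of nonlinear equations by contraction\<close>

definition solves_second_order ::
  "(real \<Rightarrow> 'a::real_normed_vector \<Rightarrow> 'a) \<Rightarrow> (real \<Rightarrow> 'a) \<Rightarrow> bool" where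
  "solves_second_order K x \<longleftrightarrow>
     (\<exists>x'. \<forall>t. (x has_vector_derivative x' t) (at t) \<and> (x' has_vector_derivative K t (x t)) (at t))"

text \<open>This places the functions in the complete space of bounded continuous functions with the
  sup metric, where the contraction principle is available.\<close>

lemma odd_periodic_bcontfun:
  fixes x :: "real \<Rightarrow> 'a::euclidean_space"
  assumes "continuous_on UNIV x" "odd_periodic x"
  obtains \<phi> :: "real \<Rightarrow>\<^sub>C 'a" where "apply_bcontfun \<phi> = x"
proof -
  have "bounded (x ` {0..pi})"
    using assms(1) by (intro compact_imp_bounded compact_continuous_image) (auto intro: continuous_on_subset)
  then obtain B where "\<And>t. t \<in> {0..pi} \<Longrightarrow> norm (x t) \<le> B"
    unfolding bounded_iff by (metis imageI)
  then have "norm (x t) \<le> B" for t by (rule odd_periodic_reduce[OF assms(2)])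
  then show thesis
    using that[of "Bcontfun x"] bcontfun_normI[OF assms(1)] Bcontfun_inverse by blast
qed

text \<open>The map sends \<open>\<phi>\<close> to an odd periodic second antiderivative of
  \<open>K t (\<phi> t)\<close>. By \<open>odd_periodic_bound\<close> it contracts the sup metric
  with factor \<open>L * pi^2\<close>, and its fixed points are the solutions.\<close>

theorem odd_periodic_solution_ex1:
  fixes K :: "real \<Rightarrow> 'a::euclidean_space \<Rightarrow> 'a"
  assumes cont: "continuous_on UNIV (\<lambda>(t, x). K t x)"
    and odd: "\<And>t x. K (- t) (- x) = - K t x" and per: "\<And>t x. K (t + 2 * pi) x = K t x"
    and lip: "\<And>t x y. norm (K t x - K t y) \<le> L * norm (x - y)" and L: "L * pi\<^sup>2 < 1"
  shows "\<exists>!x. solves_second_order K x \<and> odd_periodic x"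
proof -
  define S where "S = {\<phi> :: real \<Rightarrow>\<^sub>C 'a. odd_periodic (apply_bcontfun \<phi>)}"
  have L0: "0 \<le> L"
  proof -
    obtain b :: 'a where "norm b = 1" using norm_Basis nonempty_Basis by blast
    then show ?thesis using order_trans[OF norm_ge_zero lip[of 0 b 0]] by simp
  qed
  \<comment> \<open>Point evaluation is 1-Lipschitz, so the pointwise conditions in \<open>S\<close>
    cut out a closed set.\<close>
  have evc: "continuous_on UNIV (\<lambda>\<phi> :: real \<Rightarrow>\<^sub>C 'a. apply_bcontfun \<phi> t)" for t
    by (rule lipschitz_on_continuous_on[of 1], rule lipschitz_onI) (auto simp: dist_bounded)
  have "closed S"
    unfolding S_def odd_periodic_def
    by (intro closed_Collect_conj closed_Collect_all closed_Collect_eq continuous_on_minus evc)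
  then have cS: "complete S" by (simp add: complete_eq_closed)
  have "S \<noteq> {}" by (auto simp: S_def odd_periodic_def intro!: exI[of _ 0])
  have Kc: "continuous_on UNIV (\<lambda>t. K t (x t))" if "continuous_on UNIV x" for x
    using continuous_on_compose2[OF cont, of UNIV "\<lambda>t. (t, x t)"] that continuous_on_Pair[OF continuous_on_id that]
    by simp
  have Kop: "odd_periodic (\<lambda>t. K t (x t))" if "odd_periodic x" for x
    using that by (simp add: odd_periodic_def odd per)
  have "\<forall>\<phi>\<in>S. \<exists>\<psi>\<in>S. \<exists>w. \<forall>t. (apply_bcontfun \<psi> has_vector_derivative w t) (at t) \<and>
      (w has_vector_derivative K t (apply_bcontfun \<phi> t)) (at t)"
  proof
    fix \<phi> assume "\<phi> \<in> S"
    then have "odd_periodic (\<lambda>t. K t (apply_bcontfun \<phi> t))" by (intro Kop) (simp add: S_def)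
    moreover have "continuous_on UNIV (\<lambda>t. K t (apply_bcontfun \<phi> t))" by (intro Kc) simp
    ultimately obtain v w where vw: "\<And>t. (v has_vector_derivative w t) (at t)"
      "\<And>t. (w has_vector_derivative K t (apply_bcontfun \<phi> t)) (at t)" "odd_periodic v"
      using odd_periodic_second_antiderivative by blast
    obtain \<psi> where \<psi>: "apply_bcontfun \<psi> = v"
      using odd_periodic_bcontfun[OF has_vector_derivative_imp_continuous_on[OF vw(1)] vw(3)] .
    show "\<exists>\<psi>\<in>S. \<exists>w. \<forall>t. (apply_bcontfun \<psi> has_vector_derivative w t) (at t) \<and>
      (w has_vector_derivative K t (apply_bcontfun \<phi> t)) (at t)"
      using vw \<psi> by (intro bexI[of _ \<psi>] exI[of _ w]) (auto simp: S_def)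
  qed
  then obtain F W where F: "\<And>\<phi>. \<phi> \<in> S \<Longrightarrow> F \<phi> \<in> S"
    and FW: "\<And>\<phi> t. \<phi> \<in> S \<Longrightarrow> (apply_bcontfun (F \<phi>) has_vector_derivative W \<phi> t) (at t)"
      "\<And>\<phi> t. \<phi> \<in> S \<Longrightarrow> (W \<phi> has_vector_derivative K t (apply_bcontfun \<phi> t)) (at t)"
    by metis
  have diffb: "norm (v t - v' t) \<le> pi\<^sup>2 * k"
    if "\<And>t. (v has_vector_derivative w t) (at t)" "\<And>t. (w has_vector_derivative g t) (at t)"
      "\<And>t. (v' has_vector_derivative w' t) (at t)" "\<And>t. (w' has_vector_derivative g' t) (at t)"
      "odd_periodic v" "odd_periodic v'" "\<And>t. norm (g t - g' t) \<le> k"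
    for v w g v' w' g' :: "real \<Rightarrow> 'a" and k t
  proof (rule odd_periodic_bound)
    show "((\<lambda>t. v t - v' t) has_vector_derivative w t - w' t) (at t)"
      "((\<lambda>t. w t - w' t) has_vector_derivative g t - g' t) (at t)" for t
      using that by (auto intro!: has_vector_derivative_diff)
  qed (use that in \<open>auto simp: odd_periodic_def\<close>)
  \<comment> \<open>\<open>F\<close> comes from a choice of antiderivatives. That a solution is
    fixed by it needs uniqueness of the odd periodic second antiderivative, which is
    \<open>diffb\<close> with \<open>k = 0\<close>.\<close>
  have fix_iff: "F \<phi> = \<phi> \<longleftrightarrow> solves_second_order K (apply_bcontfun \<phi>)" if \<phi>: "\<phi> \<in> S" for \<phi>
  proof
    assume "F \<phi> = \<phi>"
    then show "solves_second_order K (apply_bcontfun \<phi>)"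
      using FW[OF \<phi>] unfolding solves_second_order_def by (metis (full_types))
  next
    assume "solves_second_order K (apply_bcontfun \<phi>)"
    then obtain x' where "\<And>t. (apply_bcontfun \<phi> has_vector_derivative x' t) (at t)"
      "\<And>t. (x' has_vector_derivative K t (apply_bcontfun \<phi> t)) (at t)"
      unfolding solves_second_order_def by blast
    then have "norm (apply_bcontfun (F \<phi>) t - apply_bcontfun \<phi> t) \<le> pi\<^sup>2 * 0" for t
      using FW[OF \<phi>] F[OF \<phi>] \<phi> by (intro diffb) (auto simp: S_def)
    then show "F \<phi> = \<phi>" by (intro bcontfun_eqI) simp
  qed
  have "\<exists>!\<phi>\<in>S. F \<phi> = \<phi>"
  proof (rule Banach_fix[OF cS \<open>S \<noteq> {}\<close>])
    show "0 \<le> L * pi\<^sup>2" using L0 by simp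
    show "dist (F x) (F y) \<le> L * pi\<^sup>2 * dist x y" if "x \<in> S" "y \<in> S" for x y
    proof (rule dist_bound)
      fix t
      have "norm (K t (apply_bcontfun x t) - K t (apply_bcontfun y t)) \<le> L * dist x y" for t
        using order_trans[OF lip mult_left_mono[OF dist_bounded[of x t y, unfolded dist_norm[of "apply_bcontfun x t"]] L0]] .
      then have "norm (apply_bcontfun (F x) t - apply_bcontfun (F y) t) \<le> pi\<^sup>2 * (L * dist x y)"
        using that FW F by (intro diffb) (auto simp: S_def)
      then show "dist (apply_bcontfun (F x) t) (apply_bcontfun (F y) t) \<le> L * pi\<^sup>2 * dist x y"
        by (simp add: dist_norm mult_ac)
    qed
  qed (use L F in auto)
  then obtain \<phi> where \<phi>: "\<phi> \<in> S" "F \<phi> = \<phi>" and uniq: "\<And>\<psi>. \<psi> \<in> S \<Longrightarrow> F \<psi> = \<psi> \<Longrightarrow> \<psi> = \<phi>"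
    by metis
  show ?thesis
  proof (rule ex1I[of _ "apply_bcontfun \<phi>"])
    show "solves_second_order K (apply_bcontfun \<phi>) \<and> odd_periodic (apply_bcontfun \<phi>)"
      using \<phi> fix_iff[of \<phi>] by (auto simp: S_def)
  next
    fix x assume x: "solves_second_order K x \<and> odd_periodic x"
    then have "continuous_on UNIV x"
      unfolding solves_second_order_def using has_vector_derivative_imp_continuous_on by blast
    then obtain \<psi> where \<psi>: "apply_bcontfun \<psi> = x" using odd_periodic_bcontfun x by blast
    then have "\<psi> \<in> S" using x by (simp add: S_def)
    then have "\<psi> = \<phi>" using uniq[of \<psi>] fix_iff[of \<psi>] x \<psi> by auto
    then show "x = apply_bcontfun \<phi>" using \<psi> by simp
  qed
qed

section \<open>The spin-spin system\<close>

lemma diag2_mult_vec: "diag2 a b *v x = vector [a * x $ 1, b * x $ 2]"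
  by (simp add: diag2_def matrix_vector_mult_def vec_eq_iff forall_2 sum_2)

lemma diag2_inner: "(diag2 a b *v x) \<bullet> y = x \<bullet> (diag2 a b *v y)"
  by (simp add: diag2_mult_vec inner_vec_def sum_2)

lemma inner_real2: "x \<bullet> y = x $ 1 * y $ 1 + x $ 2 * y $ 2" for x y :: "real ^ 2"
  by (simp add: inner_vec_def sum_2)

lemma abs_sin_diff_le: "\<bar>sin x - sin y\<bar> \<le> \<bar>x - y\<bar>" for x y :: real
proof -
  have "\<bar>sin x - sin y\<bar> = 2 * \<bar>sin ((x - y) / 2)\<bar> * \<bar>cos ((x + y) / 2)\<bar>"
    unfolding sin_diff_sin by (simp add: abs_mult)
  also have "\<dots> \<le> 2 * \<bar>(x - y) / 2\<bar> * 1"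
    by (intro mult_mono abs_sin_x_le_abs_x) auto
  finally show ?thesis by simp
qed

definition mode :: "int \<times> int \<Rightarrow> real ^ 2" where
  "mode p = vector [of_int (fst p), of_int (snd p)]"

lemma mode_nth [simp]: "mode p $ 1 = of_int (fst p)" "mode p $ 2 = of_int (snd p)"
  by (simp_all add: mode_def)

locale spin_spin =
  fixes e C1 C2 \<Lambda>1 \<Lambda>2 :: real and \<Lambda> :: "int \<Rightarrow> int \<Rightarrow> real"
  assumes e: "0 \<le> e" "e < 1" and C: "0 < C1" "0 < C2" and \<Lambda>12: "0 < \<Lambda>1" "0 < \<Lambda>2"
    and \<Lambda>_pos: "\<And>m1 m2. (m1, m2) \<in> Xi \<Longrightarrow> 0 < \<Lambda> m1 m2"
begin

abbreviation "r \<equiv> orbital_radius e"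
abbreviation "F \<equiv> spin_force e C1 C2 \<Lambda>1 \<Lambda>2 \<Lambda>"
abbreviation "sqrtC \<equiv> diag2 (sqrt C1) (sqrt C2)"
abbreviation "isqrtC \<equiv> diag2 (1 / sqrt C1) (1 / sqrt C2)"

text \<open>Both parts of the force are one sum over \<open>Xi\<close>, since \<open>(1, 0)\<close> and \<open>(0, 1)\<close> lie in \<open>Xi\<close>.\<close>

definition coef :: "real \<Rightarrow> int \<times> int \<Rightarrow> real" where
  "coef t p = (1 / r t) ^ 5 * \<Lambda> (fst p) (snd p)
     + (if p = (1, 0) then (1 / r t) ^ 3 * \<Lambda>1 else 0)
     + (if p = (0, 1) then (1 / r t) ^ 3 * \<Lambda>2 else 0)"

lemma r_pos: "0 < r t" and r_ge: "1 - e \<le> r t" and r_le: "r t \<le> 2"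
  using orbital_radius_bounds[OF e] by auto

lemma inverse_r_power_le: "(1 / r t) ^ n \<le> 1 / (1 - e) ^ n"
  using r_pos r_ge[of t] e by (simp add: power_divide) (intro frac_le power_mono, auto)

lemma coef_nonneg: "p \<in> Xi \<Longrightarrow> 0 \<le> coef t p"
  using \<Lambda>_pos[of "fst p" "snd p"] \<Lambda>12 r_pos[of t] by (auto simp: coef_def less_imp_le)

text \<open>Estimates are made for a single sum over \<open>Xi\<close>; this formula then separates
  the powers 3 and 5 of \<open>1 / r\<close> that the hypotheses treat apart. It is needed for
  vector-valued and for real \<open>h\<close>.\<close>

lemma sum_coef:
  fixes h :: "int \<times> int \<Rightarrow> 'b::real_vector"
  shows "(\<Sum>p\<in>Xi. coef t p *\<^sub>R h p) =
    (1 / r t) ^ 3 *\<^sub>R (\<Lambda>1 *\<^sub>R h (1, 0) + \<Lambda>2 *\<^sub>R h (0, 1))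
    + (1 / r t) ^ 5 *\<^sub>R (\<Sum>p\<in>Xi. \<Lambda> (fst p) (snd p) *\<^sub>R h p)"
proof -
  have mem: "(1, 0) \<in> Xi" "(0, 1) \<in> Xi" by (auto simp: Xi_def)
  have "(\<Sum>p\<in>Xi. coef t p *\<^sub>R h p) =
      (\<Sum>p\<in>Xi. (1 / r t) ^ 5 *\<^sub>R (\<Lambda> (fst p) (snd p) *\<^sub>R h p)
        + (if p = (1, 0) then ((1 / r t) ^ 3 * \<Lambda>1) *\<^sub>R h p else 0)
        + (if p = (0, 1) then ((1 / r t) ^ 3 * \<Lambda>2) *\<^sub>R h p else 0))"
    by (intro sum.cong) (auto simp: coef_def scaleR_add_left)
  then show ?thesis
    using mem finite_Xi by (simp add: sum.distrib scaleR_right.sum scaleR_add_right)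
qed

lemma spin_force_eq:
  "F t \<theta> = (\<Sum>p\<in>Xi. coef t p *\<^sub>R (sin (mode p \<bullet> \<theta>) *\<^sub>R mode p))
     + (2 * deriv (deriv (true_anomaly e)) t) *\<^sub>R vector [C1, C2]"
  unfolding sum_coef
  by (simp add: spin_force_def mode_def inner_real2 vec_eq_iff forall_2 case_prod_unfold)

lemma coef_minus: "coef (- t) p = coef t p"
  unfolding coef_def orbital_radius_minus[OF e] ..

lemma coef_periodic: "coef (t + 2 * pi) p = coef t p"
  unfolding coef_def orbital_radius_periodic[OF e] ..

lemma spin_force_minus: "F (- t) (- \<theta>) = - F t \<theta>"
  unfolding spin_force_eq
  by (simp add: coef_minus deriv2_true_anomaly_minus[OF e] sum_negf)

lemma spin_force_periodic: "F (t + 2 * pi) \<theta> = F t \<theta>"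
  unfolding spin_force_eq
  by (simp add: coef_periodic deriv2_true_anomaly_periodic[OF e])

lemma continuous_coef: "continuous_on S (\<lambda>t. coef t p)"
  unfolding coef_def using r_pos
  by (cases "p = (1, 0)"; cases "p = (0, 1)")
    (auto intro!: continuous_intros continuous_orbital_radius[OF e] simp: less_imp_neq[symmetric])

section \<open>Scaled variables and existence of \<open>\<Theta>_star\<close>\<close>

lemma sqrtC_inverse: "sqrtC *v (isqrtC *v x) = x" "isqrtC *v (sqrtC *v x) = x"
  using C by (auto simp: diag2_mult_vec vec_eq_iff forall_2)

text \<open>This is the mode in the scaled variables; its squared norm is the weight of the mode in
  \<open>stiffness\<close>.\<close>

definition \<mu> :: "int \<times> int \<Rightarrow> real ^ 2" where "\<mu> p = isqrtC *v mode p"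

lemma norm_\<mu>: "(norm (\<mu> p))\<^sup>2 = (of_int (fst p))\<^sup>2 / C1 + (of_int (snd p))\<^sup>2 / C2"
  using C by (simp add: \<mu>_def diag2_mult_vec power2_norm_eq_inner inner_real2 power_divide
    flip: power2_eq_square)

text \<open>For \<open>x = sqrtC *v \<Theta>\<close> the system reads
  \<open>x'' = scaled_force t x\<close>. Splitting the mass matrix symmetrically makes each mode act
  through \<open>\<mu> p\<close> on both sides.\<close>

definition scaled_force :: "real \<Rightarrow> real ^ 2 \<Rightarrow> real ^ 2" where
  "scaled_force t x = - (isqrtC *v F t (isqrtC *v x))"

lemma scaled_force_eq: "scaled_force t x = - ((\<Sum>p\<in>Xi. coef t p *\<^sub>R (sin (\<mu> p \<bullet> x) *\<^sub>R \<mu> p))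
     + (2 * deriv (deriv (true_anomaly e)) t) *\<^sub>R (isqrtC *v vector [C1, C2]))"
  unfolding scaled_force_def spin_force_eq
  by (simp add: \<mu>_def diag2_inner matrix_vector_right_distrib matrix_vector_mult_scaleR
      linear_sum[OF matrix_vector_mul_linear])

definition stiffness :: real where
  "stiffness = 1 / (1 - e) ^ 3 * (\<Lambda>1 / C1 + \<Lambda>2 / C2)
      + 1 / (1 - e) ^ 5 *
          (\<Sum>(m1, m2)\<in>Xi. ((of_int m1)\<^sup>2 / C1 + (of_int m2)\<^sup>2 / C2) * \<Lambda> m1 m2)"

lemma sum_coef_norm_le: "(\<Sum>p\<in>Xi. coef t p * (norm (\<mu> p))\<^sup>2) \<le> stiffness"
proof -
  have "(\<Sum>p\<in>Xi. coef t p * (norm (\<mu> p))\<^sup>2) = (1 / r t) ^ 3 * (\<Lambda>1 / C1 + \<Lambda>2 / C2)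
      + (1 / r t) ^ 5 * (\<Sum>(m1, m2)\<in>Xi. ((of_int m1)\<^sup>2 / C1 + (of_int m2)\<^sup>2 / C2) * \<Lambda> m1 m2)"
    using sum_coef[of t "\<lambda>p. (norm (\<mu> p))\<^sup>2"]
    by (simp add: norm_\<mu> case_prod_unfold mult.commute)
  also have "\<dots> \<le> stiffness"
    unfolding stiffness_def using C \<Lambda>12 \<Lambda>_pos
    by (intro add_mono mult_right_mono inverse_r_power_le sum_nonneg)
      (auto intro!: mult_nonneg_nonneg add_nonneg_nonneg simp: less_imp_le)
  finally show ?thesis .
qed

text \<open>The forcing by the true anomaly cancels in the difference. A mode contributes
  \<open>norm (\<mu> p)\<close> twice, once by Cauchy-Schwarz inside the sine and once as the
  direction of the force.\<close>

lemma scaled_force_lipschitz: "norm (scaled_force t x - scaled_force t y) \<le> stiffness * norm (x - y)"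
proof -
  have "scaled_force t x - scaled_force t y = - (\<Sum>p\<in>Xi. coef t p *\<^sub>R ((sin (\<mu> p \<bullet> x) - sin (\<mu> p \<bullet> y)) *\<^sub>R \<mu> p))"
    by (simp add: scaled_force_eq sum_subtractf scaleR_diff_left scaleR_diff_right)
  then have "norm (scaled_force t x - scaled_force t y) \<le>
      (\<Sum>p\<in>Xi. norm (coef t p *\<^sub>R ((sin (\<mu> p \<bullet> x) - sin (\<mu> p \<bullet> y)) *\<^sub>R \<mu> p)))"
    by (simp only: norm_minus_cancel norm_sum)
  also have "\<dots> \<le> (\<Sum>p\<in>Xi. coef t p * (norm (\<mu> p))\<^sup>2 * norm (x - y))"
  proof (rule sum_mono)
    fix p assume p: "p \<in> Xi"
    have "\<bar>sin (\<mu> p \<bullet> x) - sin (\<mu> p \<bullet> y)\<bar> \<le> \<bar>\<mu> p \<bullet> (x - y)\<bar>"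
      using abs_sin_diff_le by (simp add: inner_diff_right)
    also have "\<dots> \<le> norm (\<mu> p) * norm (x - y)" by (rule Cauchy_Schwarz_ineq2)
    finally have "\<bar>sin (\<mu> p \<bullet> x) - sin (\<mu> p \<bullet> y)\<bar> * norm (\<mu> p) \<le> norm (\<mu> p) * norm (x - y) * norm (\<mu> p)"
      by (rule mult_right_mono) simp
    from mult_left_mono[OF this coef_nonneg[OF p, of t]]
    show "norm (coef t p *\<^sub>R ((sin (\<mu> p \<bullet> x) - sin (\<mu> p \<bullet> y)) *\<^sub>R \<mu> p))
        \<le> coef t p * (norm (\<mu> p))\<^sup>2 * norm (x - y)"
      using coef_nonneg[OF p, of t] by (simp add: abs_mult power2_eq_square mult_ac)
  qed
  also have "\<dots> \<le> stiffness * norm (x - y)"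
    unfolding sum_distrib_right[symmetric] by (intro mult_right_mono sum_coef_norm_le) simp
  finally show ?thesis .
qed

lemma continuous_scaled_force: "continuous_on UNIV (\<lambda>(t, x). scaled_force t x)"
  unfolding scaled_force_eq case_prod_unfold
  by (intro continuous_intros continuous_on_compose2[OF continuous_coef[of UNIV]]
     continuous_on_compose2[OF continuous_deriv2_true_anomaly[OF e, of UNIV]]) auto

text \<open>This multiplies the equation of motion by \<open>C^(-1/2)\<close>,
  componentwise.\<close>

lemma mult_diag2_eq_0_iff:
  "diag2 C1 C2 *v y + z = 0 \<longleftrightarrow> sqrtC *v y = - (isqrtC *v z)"
proof -
  have *: "c * a + b = 0 \<longleftrightarrow> sqrt c * a = - (b / sqrt c)" if "0 < c" for a b c :: real
  proof -
    have "c = sqrt c * sqrt c" using that by simp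
    then show ?thesis using that by (auto simp: field_simps eq_neg_iff_add_eq_0)
  qed
  show ?thesis
    using *[OF C(1), of "y $ 1" "z $ 1"] *[OF C(2), of "y $ 2" "z $ 2"]
    by (simp add: diag2_mult_vec vec_eq_iff forall_2)
qed

lemma matrix_has_vector_derivative:
  "(f has_vector_derivative d) (at t) \<Longrightarrow> ((\<lambda>t. A *v f t) has_vector_derivative A *v d) (at t)"
  for A :: "real ^ 'm ^ 'n"
  by (rule bounded_linear.has_vector_derivative[OF matrix_vector_mul_bounded_linear])

lemma spin_solution_iff:
  "spin_solution_on UNIV e C1 C2 \<Lambda>1 \<Lambda>2 \<Lambda> \<Theta> \<longleftrightarrow> solves_second_order scaled_force (\<lambda>t. sqrtC *v \<Theta> t)"
proof
  assume "spin_solution_on UNIV e C1 C2 \<Lambda>1 \<Lambda>2 \<Lambda> \<Theta>"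
  then obtain \<Theta>' \<Theta>'' where 1: "\<And>t. (\<Theta> has_vector_derivative \<Theta>' t) (at t)"
    and 2: "\<And>t. (\<Theta>' has_vector_derivative \<Theta>'' t) (at t)"
    and 3: "\<And>t. diag2 C1 C2 *v \<Theta>'' t + F t (\<Theta> t) = 0"
    unfolding spin_solution_on_def by auto
  have "scaled_force t (sqrtC *v \<Theta> t) = sqrtC *v \<Theta>'' t" for t
    using 3[of t] unfolding mult_diag2_eq_0_iff scaled_force_def sqrtC_inverse by simp
  then show "solves_second_order scaled_force (\<lambda>t. sqrtC *v \<Theta> t)"
    unfolding solves_second_order_def
    using matrix_has_vector_derivative[OF 1, of sqrtC] matrix_has_vector_derivative[OF 2, of sqrtC]
    by (intro exI[of _ "\<lambda>t. sqrtC *v \<Theta>' t"]) simp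
next
  assume "solves_second_order scaled_force (\<lambda>t. sqrtC *v \<Theta> t)"
  then obtain x' where 1: "\<And>t. ((\<lambda>t. sqrtC *v \<Theta> t) has_vector_derivative x' t) (at t)"
    and 2: "\<And>t. (x' has_vector_derivative scaled_force t (sqrtC *v \<Theta> t)) (at t)"
    unfolding solves_second_order_def by auto
  have "diag2 C1 C2 *v (isqrtC *v scaled_force t (sqrtC *v \<Theta> t)) + F t (\<Theta> t) = 0" for t
    unfolding mult_diag2_eq_0_iff sqrtC_inverse by (simp add: scaled_force_def sqrtC_inverse)
  then show "spin_solution_on UNIV e C1 C2 \<Lambda>1 \<Lambda>2 \<Lambda> \<Theta>"
    unfolding spin_solution_on_def
    using matrix_has_vector_derivative[OF 1, of isqrtC] matrix_has_vector_derivative[OF 2, of isqrtC]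
    by (intro exI[of _ "\<lambda>t. isqrtC *v x' t"] exI[of _ "\<lambda>t. isqrtC *v scaled_force t (sqrtC *v \<Theta> t)"])
      (simp add: sqrtC_inverse)
qed

lemma matrix_mult_minus: "A *v (- x) = - (A *v x)" for A :: "real ^ 'm ^ 'n"
  using matrix_vector_mult_scaleR[of A "-1" x] by simp

lemma odd_periodic_mult: "odd_periodic x \<Longrightarrow> odd_periodic (\<lambda>t. A *v x t)" for A :: "real ^ 'm ^ 'n"
  by (simp add: odd_periodic_def matrix_mult_minus)

lemma spin_solution_ex1:
  assumes "stiffness < 1 / pi\<^sup>2"
  shows "\<exists>!\<Theta>. spin_solution_on UNIV e C1 C2 \<Lambda>1 \<Lambda>2 \<Lambda> \<Theta> \<and> odd_periodic \<Theta>"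
proof -
  have "stiffness * pi\<^sup>2 < 1" using assms by (simp add: field_simps)
  then have "\<exists>!x. solves_second_order scaled_force x \<and> odd_periodic x"
    using scaled_force_lipschitz continuous_scaled_force
    by (intro odd_periodic_solution_ex1[of scaled_force stiffness])
      (auto simp: scaled_force_def matrix_mult_minus spin_force_minus spin_force_periodic)
  then obtain x where x: "solves_second_order scaled_force x" "odd_periodic x"
    and uniq: "\<And>y. solves_second_order scaled_force y \<Longrightarrow> odd_periodic y \<Longrightarrow> y = x"
    by blast
  show ?thesis
  proof (rule ex1I[of _ "\<lambda>t. isqrtC *v x t"])
    show "spin_solution_on UNIV e C1 C2 \<Lambda>1 \<Lambda>2 \<Lambda> (\<lambda>t. isqrtC *v x t) \<and> odd_periodic (\<lambda>t. isqrtC *v x t)"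
      using x by (simp add: spin_solution_iff sqrtC_inverse odd_periodic_mult)
  next
    fix \<Theta> assume "spin_solution_on UNIV e C1 C2 \<Lambda>1 \<Lambda>2 \<Lambda> \<Theta> \<and> odd_periodic \<Theta>"
    then have "(\<lambda>t. sqrtC *v \<Theta> t) = x"
      by (intro uniq) (auto simp: spin_solution_iff odd_periodic_mult)
    then show "\<Theta> = (\<lambda>t. isqrtC *v x t)" by (auto simp: sqrtC_inverse)
  qed
qed

text \<open>An odd periodic solution on the line satisfies the Dirichlet problem automatically, so
  the description defining \<open>\<Theta>_star\<close> reduces to the unique odd periodic
  solution.\<close>

lemma \<Theta>_star_solution:
  assumes "stiffness < 1 / pi\<^sup>2"
  shows "spin_solution_on UNIV e C1 C2 \<Lambda>1 \<Lambda>2 \<Lambda> (\<Theta>_star e C1 C2 \<Lambda>1 \<Lambda>2 \<Lambda>)"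
    and "odd_periodic (\<Theta>_star e C1 C2 \<Lambda>1 \<Lambda>2 \<Lambda>)"
proof -
  let ?P = "\<lambda>\<Theta>. Dirichlet_solution e C1 C2 \<Lambda>1 \<Lambda>2 \<Lambda> \<Theta> \<and> spin_solution_on UNIV e C1 C2 \<Lambda>1 \<Lambda>2 \<Lambda> \<Theta> \<and>
        (\<forall>t. \<Theta> (- t) = - \<Theta> t) \<and> (\<forall>t. \<Theta> (t + 2 * pi) = \<Theta> t)"
  have "Dirichlet_solution e C1 C2 \<Lambda>1 \<Lambda>2 \<Lambda> \<Theta>"
    if "spin_solution_on UNIV e C1 C2 \<Lambda>1 \<Lambda>2 \<Lambda> \<Theta>" "odd_periodic \<Theta>" for \<Theta>
    using that odd_periodic_zero[OF that(2)]
    unfolding Dirichlet_solution_def spin_solution_on_def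
    by (auto intro: has_vector_derivative_at_within)
  then have "?P \<Theta> \<longleftrightarrow> spin_solution_on UNIV e C1 C2 \<Lambda>1 \<Lambda>2 \<Lambda> \<Theta> \<and> odd_periodic \<Theta>" for \<Theta>
    unfolding odd_periodic_def by blast
  then have "\<exists>!\<Theta>. ?P \<Theta>" using spin_solution_ex1[OF assms] by simp
  from theI'[OF this] show "spin_solution_on UNIV e C1 C2 \<Lambda>1 \<Lambda>2 \<Lambda> (\<Theta>_star e C1 C2 \<Lambda>1 \<Lambda>2 \<Lambda>)"
    and "odd_periodic (\<Theta>_star e C1 C2 \<Lambda>1 \<Lambda>2 \<Lambda>)"
    unfolding \<Theta>_star_def[symmetric] odd_periodic_def by auto
qed

text \<open>Each sine is at most 1 in modulus, which bounds every component of the acceleration by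
  \<open>M\<close>; the factor \<open>pi^2\<close> is that of \<open>odd_periodic_bound\<close>.
  Working by components produces the maxima in \<open>M\<close>.\<close>

lemma spin_solution_bound:
  assumes sol: "spin_solution_on UNIV e C1 C2 \<Lambda>1 \<Lambda>2 \<Lambda> \<Theta>" and op: "odd_periodic \<Theta>"
    and M: "M = 1 / (1 - e) ^ 3 * max (\<Lambda>1 / C1) (\<Lambda>2 / C2)
      + 1 / (1 - e) ^ 5 *
          (\<Sum>(m1, m2)\<in>Xi. max (\<bar>of_int m1\<bar> / C1) (\<bar>of_int m2\<bar> / C2) * \<Lambda> m1 m2)
      + 4 * e * sqrt (1 - e\<^sup>2) / (1 - e) ^ 4"
  shows "\<bar>\<Theta> t $ j\<bar> \<le> pi\<^sup>2 * M"
proof -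
  define Cj where "Cj = (\<lambda>j::2. if j = 1 then C1 else C2)"
  have Cj: "0 < Cj j" using C by (simp add: Cj_def)
  obtain \<Theta>' \<Theta>'' where 1: "\<And>t. (\<Theta> has_vector_derivative \<Theta>' t) (at t)"
    and 2: "\<And>t. (\<Theta>' has_vector_derivative \<Theta>'' t) (at t)"
    and 3: "\<And>t. diag2 C1 C2 *v \<Theta>'' t + F t (\<Theta> t) = 0"
    using sol unfolding spin_solution_on_def by auto
  have comp: "((\<lambda>t. f t $ j) has_vector_derivative f' t $ j) (at t)"
    if "\<And>t. (f has_vector_derivative f' t) (at t)" for f f' :: "real \<Rightarrow> real ^ 2" and t
    by (rule bounded_linear.has_vector_derivative[OF bounded_linear_vec_nth that])
  have "\<bar>\<Theta>'' t $ j\<bar> \<le> M" for t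
  proof -
    have "Cj j * \<Theta>'' t $ j = - (F t (\<Theta> t) $ j)"
      using arg_cong[OF 3[of t], of "\<lambda>x. x $ j"] exhaust_2[of j]
      by (auto simp: diag2_mult_vec Cj_def)
    also have "\<dots> = - ((\<Sum>p\<in>Xi. coef t p * (sin (mode p \<bullet> \<Theta> t) * mode p $ j))
        + 2 * deriv (deriv (true_anomaly e)) t * Cj j)"
      unfolding spin_force_eq using exhaust_2[of j] by (auto simp: Cj_def mult.assoc)
    finally have "\<Theta>'' t $ j = - ((\<Sum>p\<in>Xi. coef t p * (sin (mode p \<bullet> \<Theta> t) * mode p $ j)) / Cj j
        + 2 * deriv (deriv (true_anomaly e)) t)"
      using Cj by (simp add: field_simps)
    then have b0: "\<bar>\<Theta>'' t $ j\<bar> \<le> \<bar>\<Sum>p\<in>Xi. coef t p * (sin (mode p \<bullet> \<Theta> t) * mode p $ j)\<bar> / Cj j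
        + 2 * \<bar>deriv (deriv (true_anomaly e)) t\<bar>"
      using Cj abs_triangle_ineq[of "(\<Sum>p\<in>Xi. coef t p * (sin (mode p \<bullet> \<Theta> t) * mode p $ j)) / Cj j"
        "2 * deriv (deriv (true_anomaly e)) t"]
      by (simp add: abs_mult)
    have b1: "\<bar>\<Sum>p\<in>Xi. coef t p * (sin (mode p \<bullet> \<Theta> t) * mode p $ j)\<bar> / Cj j
        \<le> (\<Sum>p\<in>Xi. coef t p * (\<bar>mode p $ j\<bar> / Cj j))"
    proof -
      have "\<bar>\<Sum>p\<in>Xi. coef t p * (sin (mode p \<bullet> \<Theta> t) * mode p $ j)\<bar>
          \<le> (\<Sum>p\<in>Xi. \<bar>coef t p * (sin (mode p \<bullet> \<Theta> t) * mode p $ j)\<bar>)"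
        by (rule sum_abs)
      also have "\<dots> \<le> (\<Sum>p\<in>Xi. coef t p * \<bar>mode p $ j\<bar>)"
      proof (rule sum_mono)
        fix p assume p: "p \<in> Xi"
        have "\<bar>sin (mode p \<bullet> \<Theta> t)\<bar> * \<bar>mode p $ j\<bar> \<le> 1 * \<bar>mode p $ j\<bar>"
          by (intro mult_right_mono) auto
        from mult_left_mono[OF this coef_nonneg[OF p, of t]] coef_nonneg[OF p, of t]
        show "\<bar>coef t p * (sin (mode p \<bullet> \<Theta> t) * mode p $ j)\<bar> \<le> coef t p * \<bar>mode p $ j\<bar>"
          by (simp add: abs_mult)
      qed
      finally have "\<bar>\<Sum>p\<in>Xi. coef t p * (sin (mode p \<bullet> \<Theta> t) * mode p $ j)\<bar> / Cj j
          \<le> (\<Sum>p\<in>Xi. coef t p * \<bar>mode p $ j\<bar>) / Cj j"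
        using Cj by (intro divide_right_mono) auto
      then show ?thesis by (simp add: sum_divide_distrib)
    qed
    have b2: "(\<Sum>p\<in>Xi. coef t p * (\<bar>mode p $ j\<bar> / Cj j)) =
        (1 / r t) ^ 3 * (\<Lambda>1 * (\<bar>mode (1, 0) $ j\<bar> / Cj j) + \<Lambda>2 * (\<bar>mode (0, 1) $ j\<bar> / Cj j))
        + (1 / r t) ^ 5 * (\<Sum>p\<in>Xi. \<Lambda> (fst p) (snd p) * (\<bar>mode p $ j\<bar> / Cj j))"
      using sum_coef[of t "\<lambda>p. \<bar>mode p $ j\<bar> / Cj j"] by simp
    \<comment> \<open>Only one of the two unit modes acts on component \<open>j\<close>; the maximum
      makes the bound independent of \<open>j\<close>.\<close>
    have b3: "(1 / r t) ^ 3 * (\<Lambda>1 * (\<bar>mode (1, 0) $ j\<bar> / Cj j) + \<Lambda>2 * (\<bar>mode (0, 1) $ j\<bar> / Cj j))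
        \<le> (1 / r t) ^ 3 * max (\<Lambda>1 / C1) (\<Lambda>2 / C2)"
      using exhaust_2[of j] r_pos[of t] by (intro mult_left_mono) (auto simp: Cj_def less_imp_le)
    have b4: "(1 / r t) ^ 5 * (\<Sum>p\<in>Xi. \<Lambda> (fst p) (snd p) * (\<bar>mode p $ j\<bar> / Cj j))
        \<le> (1 / r t) ^ 5 * (\<Sum>p\<in>Xi. \<Lambda> (fst p) (snd p) * max (\<bar>of_int (fst p)\<bar> / C1) (\<bar>of_int (snd p)\<bar> / C2))"
      using exhaust_2[of j] \<Lambda>_pos r_pos[of t]
      by (intro mult_left_mono[OF sum_mono] mult_left_mono) (auto simp: Cj_def less_imp_le)
    have b5: "(1 / r t) ^ 3 * max (\<Lambda>1 / C1) (\<Lambda>2 / C2) \<le> 1 / (1 - e) ^ 3 * max (\<Lambda>1 / C1) (\<Lambda>2 / C2)"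
      using C \<Lambda>12 by (intro mult_right_mono inverse_r_power_le) (simp add: le_max_iff_disj)
    have b6: "(1 / r t) ^ 5 * (\<Sum>p\<in>Xi. \<Lambda> (fst p) (snd p) * max (\<bar>of_int (fst p)\<bar> / C1) (\<bar>of_int (snd p)\<bar> / C2))
        \<le> 1 / (1 - e) ^ 5 * (\<Sum>p\<in>Xi. \<Lambda> (fst p) (snd p) * max (\<bar>of_int (fst p)\<bar> / C1) (\<bar>of_int (snd p)\<bar> / C2))"
      using C \<Lambda>_pos
      by (intro mult_right_mono inverse_r_power_le sum_nonneg mult_nonneg_nonneg)
        (auto simp: le_max_iff_disj less_imp_le)
    have b7: "\<bar>deriv (deriv (true_anomaly e)) t\<bar> \<le> 2 * e * sqrt (1 - e\<^sup>2) / (1 - e) ^ 4"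
      by (rule deriv2_true_anomaly_bound[OF e])
    have b8: "1 / (1 - e) ^ 3 * max (\<Lambda>1 / C1) (\<Lambda>2 / C2)
      + 1 / (1 - e) ^ 5 * (\<Sum>p\<in>Xi. \<Lambda> (fst p) (snd p) * max (\<bar>of_int (fst p)\<bar> / C1) (\<bar>of_int (snd p)\<bar> / C2))
      + 2 * (2 * e * sqrt (1 - e\<^sup>2) / (1 - e) ^ 4) = M"
      unfolding M by (simp add: case_prod_unfold mult.commute)
    show ?thesis using b0 b1 b2 b3 b4 b5 b6 b7 b8 by linarith
  qed
  then have "norm (\<Theta> t $ j) \<le> pi\<^sup>2 * M"
    using op
    by (intro odd_periodic_bound[OF comp[OF 1] comp[OF 2]]) (auto simp: odd_periodic_def)
  then show ?thesis by simp
qed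

section \<open>The linearization as a sum of rank-one matrices, and its spectral bounds\<close>

definition scaled_jacobian :: "(real \<Rightarrow> real ^ 2) \<Rightarrow> real \<Rightarrow> real ^ 2 ^ 2" where
  "scaled_jacobian \<Theta> t = (\<chi> i j. \<Sum>p\<in>Xi. coef t p * cos (mode p \<bullet> \<Theta> t) * \<mu> p $ i * \<mu> p $ j)"

lemma scaled_jacobian_mult: "scaled_jacobian \<Theta> t *v x = (\<Sum>p\<in>Xi. (coef t p * cos (mode p \<bullet> \<Theta> t) * (\<mu> p \<bullet> x)) *\<^sub>R \<mu> p)"
  by (simp add: scaled_jacobian_def matrix_vector_mult_def vec_eq_iff sum_2 inner_real2 sum_distrib_right
      flip: sum.distrib) (simp add: algebra_simps)

text \<open>The derivative of the force is computed mode by mode and the two matrices are compared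
  on vectors; the symmetric factor \<open>isqrtC\<close> moves across the inner product and turns
  \<open>mode p\<close> into \<open>\<mu> p\<close>.\<close>

lemma linearization_eq: "linearization e C1 C2 \<Lambda>1 \<Lambda>2 \<Lambda> \<Theta> = scaled_jacobian \<Theta>"
proof
  fix t
  let ?J = "\<lambda>h. \<Sum>p\<in>Xi. coef t p *\<^sub>R ((cos (mode p \<bullet> \<Theta> t) * (mode p \<bullet> h)) *\<^sub>R mode p)"
  have "(F t has_derivative ?J) (at (\<Theta> t))"
    unfolding spin_force_eq by (auto intro!: derivative_eq_intros simp: mult.commute)
  then have J: "frechet_derivative (F t) (at (\<Theta> t)) = ?J" and lJ: "linear ?J"
    by (auto simp: frechet_derivative_at[symmetric] dest: has_derivative_linear)
  have "linearization e C1 C2 \<Lambda>1 \<Lambda>2 \<Lambda> \<Theta> t *v x = scaled_jacobian \<Theta> t *v x" for x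
  proof -
    have "linearization e C1 C2 \<Lambda>1 \<Lambda>2 \<Lambda> \<Theta> t *v x = isqrtC *v ?J (isqrtC *v x)"
      unfolding linearization_def jacobian_def J matrix_vector_mul_assoc[symmetric]
        fun_cong[OF matrix_vector_mul(2)[OF lJ]] ..
    also have "\<dots> = scaled_jacobian \<Theta> t *v x"
      by (simp add: scaled_jacobian_mult \<mu>_def diag2_inner matrix_vector_mult_scaleR mult.assoc
          linear_sum[OF matrix_vector_mul_linear])
    finally show ?thesis .
  qed
  then show "linearization e C1 C2 \<Lambda>1 \<Lambda>2 \<Lambda> \<Theta> t = scaled_jacobian \<Theta> t" by (simp add: matrix_eq)
qed

lemma Hill_coefficient_scaled_jacobian:
  assumes "continuous_on UNIV \<Theta>" "\<And>t. \<Theta> (t + 2 * pi) = \<Theta> t"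
  shows "Hill_coefficient (2 * pi) (scaled_jacobian \<Theta>)"
  unfolding Hill_coefficient_def
proof (intro conjI allI)
  show "transpose (scaled_jacobian \<Theta> t) = scaled_jacobian \<Theta> t" for t
    by (simp add: transpose_def scaled_jacobian_def vec_eq_iff mult_ac)
  show "scaled_jacobian \<Theta> (t + 2 * pi) = scaled_jacobian \<Theta> t" for t
    using assms(2) by (simp add: scaled_jacobian_def coef_periodic)
  have "continuous_on {a..b} (scaled_jacobian \<Theta>)" for a b
    unfolding scaled_jacobian_def
    by (intro continuous_on_vec_lambda continuous_intros continuous_coef
        continuous_on_subset[OF assms(1)]) auto
  then show "scaled_jacobian \<Theta> absolutely_integrable_on {a..b}" for a b
    by (rule absolutely_integrable_continuous_real)
qed

lemma scaled_jacobian_inner: "(scaled_jacobian \<Theta> t *v x) \<bullet> x = (\<Sum>p\<in>Xi. coef t p * (cos (mode p \<bullet> \<Theta> t) * (\<mu> p \<bullet> x)\<^sup>2))"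
  by (simp add: scaled_jacobian_mult inner_sum_left power2_eq_square mult_ac)

text \<open>Cosines are at most 1, so the constant is the same as for the Lipschitz bound.\<close>

lemma scaled_jacobian_upper: "(scaled_jacobian \<Theta> t *v x) \<bullet> x \<le> stiffness * (x \<bullet> x)"
proof -
  have "(scaled_jacobian \<Theta> t *v x) \<bullet> x \<le> (\<Sum>p\<in>Xi. coef t p * (norm (\<mu> p))\<^sup>2 * (x \<bullet> x))"
    unfolding scaled_jacobian_inner
  proof (rule sum_mono)
    fix p assume p: "p \<in> Xi"
    have "cos (mode p \<bullet> \<Theta> t) * (\<mu> p \<bullet> x)\<^sup>2 \<le> 1 * (\<mu> p \<bullet> x)\<^sup>2"
      by (intro mult_right_mono) auto
    also have "\<dots> \<le> (norm (\<mu> p))\<^sup>2 * (x \<bullet> x)"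
      using Cauchy_Schwarz_ineq[of "\<mu> p" x] by (simp add: power2_norm_eq_inner)
    finally show "coef t p * (cos (mode p \<bullet> \<Theta> t) * (\<mu> p \<bullet> x)\<^sup>2) \<le> coef t p * (norm (\<mu> p))\<^sup>2 * (x \<bullet> x)"
      unfolding mult.assoc by (rule mult_left_mono) (rule coef_nonneg[OF p])
  qed
  also have "\<dots> \<le> stiffness * (x \<bullet> x)"
    unfolding sum_distrib_right[symmetric] by (intro mult_right_mono sum_coef_norm_le) simp
  finally show ?thesis .
qed

text \<open>Divided by \<open>(1 - e)^2\<close>, \<open>coupling1\<close> and
  \<open>coupling2\<close> are the quantities \<open>\<alpha>1 * (\<Lambda>1 / C1)\<close> and
  \<open>\<alpha>2 * (\<Lambda>2 / C2)\<close> of the third hypothesis.\<close>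

definition coupling1 :: real where
  "coupling1 = (\<Sum>(m1, m2)\<in>Xi. ((of_int m1)\<^sup>2 / C1 + \<bar>of_int (m1 * m2)\<bar> / sqrt (C1 * C2)) * \<Lambda> m1 m2)"

definition coupling2 :: real where
  "coupling2 = (\<Sum>(m1, m2)\<in>Xi. ((of_int m2)\<^sup>2 / C2 + \<bar>of_int (m1 * m2)\<bar> / sqrt (C1 * C2)) * \<Lambda> m1 m2)"

text \<open>The mixed term is split evenly between the squares of the coordinates, as in a diagonal
  dominance argument; this is the source of the terms with \<open>sqrt (C1 * C2)\<close>.\<close>

lemma \<mu>_inner_square_le:
  "(\<mu> p \<bullet> x)\<^sup>2 \<le>
    ((of_int (fst p))\<^sup>2 / C1 + \<bar>of_int (fst p * snd p)\<bar> / sqrt (C1 * C2)) * (x $ 1)\<^sup>2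
    + ((of_int (snd p))\<^sup>2 / C2 + \<bar>of_int (fst p * snd p)\<bar> / sqrt (C1 * C2)) * (x $ 2)\<^sup>2"
proof -
  define a b where "a = of_int (fst p) / sqrt C1" and "b = of_int (snd p) / sqrt C2"
  have ab: "a\<^sup>2 = (of_int (fst p))\<^sup>2 / C1" "b\<^sup>2 = (of_int (snd p))\<^sup>2 / C2"
    "\<bar>a * b\<bar> = \<bar>of_int (fst p * snd p)\<bar> / sqrt (C1 * C2)"
    using C by (auto simp: a_def b_def power_divide abs_mult real_sqrt_mult abs_divide)
  have "2 * (a * b) * (x $ 1 * x $ 2) \<le> 2 * \<bar>a * b\<bar> * \<bar>x $ 1 * x $ 2\<bar>"
    using abs_ge_self[of "(a * b) * (x $ 1 * x $ 2)"] by (simp add: abs_mult mult_ac)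
  also have "\<dots> \<le> \<bar>a * b\<bar> * ((x $ 1)\<^sup>2 + (x $ 2)\<^sup>2)"
  proof -
    have "2 * \<bar>x $ 1 * x $ 2\<bar> \<le> (x $ 1)\<^sup>2 + (x $ 2)\<^sup>2"
      using sum_squares_bound[of "\<bar>x $ 1\<bar>" "\<bar>x $ 2\<bar>"] by (simp add: abs_mult)
    from mult_left_mono[OF this, of "\<bar>a * b\<bar>"] show ?thesis by (simp add: mult_ac)
  qed
  finally have "(a * x $ 1 + b * x $ 2)\<^sup>2 \<le>
      (a\<^sup>2 + \<bar>a * b\<bar>) * (x $ 1)\<^sup>2 + (b\<^sup>2 + \<bar>a * b\<bar>) * (x $ 2)\<^sup>2"
    by (simp add: power2_sum power_mult_distrib distrib_left distrib_right mult_ac)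
  moreover have "\<mu> p \<bullet> x = a * x $ 1 + b * x $ 2"
    by (simp add: \<mu>_def diag2_mult_vec inner_real2 a_def b_def)
  ultimately show ?thesis unfolding ab by simp
qed

text \<open>The terms with \<open>\<Lambda>1\<close> and \<open>\<Lambda>2\<close> are positive
  because the cosines are at least \<open>c\<close>; in the terms with
  \<open>\<Lambda> m1 m2\<close> the cosine is only bounded by -1 from below. Factoring out
  \<open>(1 / r) ^ 3\<close> leaves \<open>(1 / r) ^ 2\<close> on the latter, whence the power 2 of
  \<open>1 - e\<close>.\<close>

lemma scaled_jacobian_lower:
  assumes c: "0 \<le> c" "\<And>j. c \<le> cos (\<Theta> t $ j)"
    and \<kappa>: "0 \<le> \<kappa>" "\<kappa> \<le> c * min (\<Lambda>1 / C1) (\<Lambda>2 / C2) - coupling1 / (1 - e)\<^sup>2"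
      "\<kappa> \<le> c * min (\<Lambda>1 / C1) (\<Lambda>2 / C2) - coupling2 / (1 - e)\<^sup>2"
  shows "\<kappa> / 8 * (x \<bullet> x) \<le> (scaled_jacobian \<Theta> t *v x) \<bullet> x"
proof -
  let ?R = "1 / r t" and ?x1 = "(x $ 1)\<^sup>2" and ?x2 = "(x $ 2)\<^sup>2"
  have R: "0 < ?R" using r_pos by simp
  \<comment> \<open>This uniform lower bound, from \<open>r t \<le> 2\<close>, is the origin of the
    constant \<open>\<kappa> / 8\<close>.\<close>
  have R8: "1 / 8 \<le> ?R ^ 3"
    using power_mono[of "1 / 2" ?R 3] r_le[of t] r_pos[of t] by (simp add: field_simps power_divide)
  have coupling_nonneg: "0 \<le> coupling1" "0 \<le> coupling2"
    unfolding coupling1_def coupling2_def using C \<Lambda>_pos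
    by (auto intro!: sum_nonneg mult_nonneg_nonneg add_nonneg_nonneg simp: less_imp_le)
  have eq: "(scaled_jacobian \<Theta> t *v x) \<bullet> x = ?R ^ 3 * (\<Lambda>1 / C1 * cos (\<Theta> t $ 1) * ?x1 + \<Lambda>2 / C2 * cos (\<Theta> t $ 2) * ?x2)
     + ?R ^ 5 * (\<Sum>p\<in>Xi. \<Lambda> (fst p) (snd p) * (cos (mode p \<bullet> \<Theta> t) * (\<mu> p \<bullet> x)\<^sup>2))"
    unfolding scaled_jacobian_inner
    using sum_coef[of t "\<lambda>p. cos (mode p \<bullet> \<Theta> t) * (\<mu> p \<bullet> x)\<^sup>2"] C
    by (simp add: inner_real2 \<mu>_def diag2_mult_vec power_divide power_mult_distrib)
  have "coupling1 * ?x1 + coupling2 * ?x2 =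
     (\<Sum>p\<in>Xi. \<Lambda> (fst p) (snd p) *
      (((of_int (fst p))\<^sup>2 / C1 + \<bar>of_int (fst p * snd p)\<bar> / sqrt (C1 * C2)) * ?x1
      + ((of_int (snd p))\<^sup>2 / C2 + \<bar>of_int (fst p * snd p)\<bar> / sqrt (C1 * C2)) * ?x2))"
    unfolding coupling1_def coupling2_def sum_distrib_right sum.distrib[symmetric] case_prod_unfold
    by (intro sum.cong refl) (simp add: algebra_simps)
  then have "- (coupling1 * ?x1 + coupling2 * ?x2) =
     - (\<Sum>p\<in>Xi. \<Lambda> (fst p) (snd p) *
      (((of_int (fst p))\<^sup>2 / C1 + \<bar>of_int (fst p * snd p)\<bar> / sqrt (C1 * C2)) * ?x1
      + ((of_int (snd p))\<^sup>2 / C2 + \<bar>of_int (fst p * snd p)\<bar> / sqrt (C1 * C2)) * ?x2))"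
    by simp
  also have "\<dots> \<le> (\<Sum>p\<in>Xi. \<Lambda> (fst p) (snd p) * (cos (mode p \<bullet> \<Theta> t) * (\<mu> p \<bullet> x)\<^sup>2))"
    unfolding sum_negf[symmetric]
  proof (rule sum_mono)
    fix p assume p: "p \<in> Xi"
    have "- 1 * (\<mu> p \<bullet> x)\<^sup>2 \<le> cos (mode p \<bullet> \<Theta> t) * (\<mu> p \<bullet> x)\<^sup>2"
      by (intro mult_right_mono) auto
    then have "- (((of_int (fst p))\<^sup>2 / C1 + \<bar>of_int (fst p * snd p)\<bar> / sqrt (C1 * C2)) * ?x1
        + ((of_int (snd p))\<^sup>2 / C2 + \<bar>of_int (fst p * snd p)\<bar> / sqrt (C1 * C2)) * ?x2)
        \<le> cos (mode p \<bullet> \<Theta> t) * (\<mu> p \<bullet> x)\<^sup>2"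
      using \<mu>_inner_square_le[of p x] by linarith
    moreover have "0 \<le> \<Lambda> (fst p) (snd p)" using \<Lambda>_pos[of "fst p" "snd p"] p by simp
    ultimately have "\<Lambda> (fst p) (snd p) * - (((of_int (fst p))\<^sup>2 / C1 + \<bar>of_int (fst p * snd p)\<bar> / sqrt (C1 * C2)) * ?x1
        + ((of_int (snd p))\<^sup>2 / C2 + \<bar>of_int (fst p * snd p)\<bar> / sqrt (C1 * C2)) * ?x2)
        \<le> \<Lambda> (fst p) (snd p) * (cos (mode p \<bullet> \<Theta> t) * (\<mu> p \<bullet> x)\<^sup>2)"
      by (rule mult_left_mono)
    then show "- (\<Lambda> (fst p) (snd p) *
      (((of_int (fst p))\<^sup>2 / C1 + \<bar>of_int (fst p * snd p)\<bar> / sqrt (C1 * C2)) * ?x1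
      + ((of_int (snd p))\<^sup>2 / C2 + \<bar>of_int (fst p * snd p)\<bar> / sqrt (C1 * C2)) * ?x2))
      \<le> \<Lambda> (fst p) (snd p) * (cos (mode p \<bullet> \<Theta> t) * (\<mu> p \<bullet> x)\<^sup>2)"
      by (simp only: mult_minus_right)
  qed
  finally have "?R ^ 5 * - (coupling1 * ?x1 + coupling2 * ?x2) \<le>
      ?R ^ 5 * (\<Sum>p\<in>Xi. \<Lambda> (fst p) (snd p) * (cos (mode p \<bullet> \<Theta> t) * (\<mu> p \<bullet> x)\<^sup>2))"
    using R by (intro mult_left_mono) auto
  moreover have "?R ^ 5 * (coupling1 * ?x1 + coupling2 * ?x2)
      \<le> ?R ^ 3 * (coupling1 / (1 - e)\<^sup>2 * ?x1 + coupling2 / (1 - e)\<^sup>2 * ?x2)"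
  proof -
    have "?R ^ 5 = ?R ^ 3 * ?R ^ 2" by (simp flip: power_add)
    then have "?R ^ 5 * (coupling1 * ?x1 + coupling2 * ?x2)
        = ?R ^ 3 * (?R ^ 2 * (coupling1 * ?x1 + coupling2 * ?x2))" by simp
    also have "\<dots> \<le> ?R ^ 3 * (1 / (1 - e) ^ 2 * (coupling1 * ?x1 + coupling2 * ?x2))"
      using R coupling_nonneg by (intro mult_left_mono mult_right_mono inverse_r_power_le) auto
    also have "1 / (1 - e) ^ 2 * (coupling1 * ?x1 + coupling2 * ?x2)
        = coupling1 / (1 - e)\<^sup>2 * ?x1 + coupling2 / (1 - e)\<^sup>2 * ?x2"
      by (simp add: add_divide_distrib)
    finally show ?thesis .
  qed
  moreover have "?R ^ 3 * (\<kappa> * (x \<bullet> x) + (coupling1 / (1 - e)\<^sup>2 * ?x1 + coupling2 / (1 - e)\<^sup>2 * ?x2))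
    \<le> ?R ^ 3 * (\<Lambda>1 / C1 * cos (\<Theta> t $ 1) * ?x1 + \<Lambda>2 / C2 * cos (\<Theta> t $ 2) * ?x2)"
  proof (rule mult_left_mono)
    have "c * min (\<Lambda>1 / C1) (\<Lambda>2 / C2) \<le> cos (\<Theta> t $ 1) * (\<Lambda>1 / C1)"
      "c * min (\<Lambda>1 / C1) (\<Lambda>2 / C2) \<le> cos (\<Theta> t $ 2) * (\<Lambda>2 / C2)"
      using c(2)[of 1] c(2)[of 2] c(1) C \<Lambda>12 order_trans[OF c(1) c(2)]
      by (intro mult_mono; simp)+
    then have "(\<kappa> + coupling1 / (1 - e)\<^sup>2) * ?x1 \<le> (cos (\<Theta> t $ 1) * (\<Lambda>1 / C1)) * ?x1"
      "(\<kappa> + coupling2 / (1 - e)\<^sup>2) * ?x2 \<le> (cos (\<Theta> t $ 2) * (\<Lambda>2 / C2)) * ?x2"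
      using \<kappa> by (intro mult_right_mono; simp)+
    then show "\<kappa> * (x \<bullet> x) + (coupling1 / (1 - e)\<^sup>2 * ?x1 + coupling2 / (1 - e)\<^sup>2 * ?x2)
      \<le> \<Lambda>1 / C1 * cos (\<Theta> t $ 1) * ?x1 + \<Lambda>2 / C2 * cos (\<Theta> t $ 2) * ?x2"
      by (simp add: inner_real2 power2_eq_square algebra_simps)
  qed (use R in simp)
  ultimately have "?R ^ 3 * (\<kappa> * (x \<bullet> x)) \<le> (scaled_jacobian \<Theta> t *v x) \<bullet> x"
    unfolding eq mult_minus_right distrib_left by linarith
  moreover have "1 / 8 * (\<kappa> * (x \<bullet> x)) \<le> ?R ^ 3 * (\<kappa> * (x \<bullet> x))"
    using \<kappa> R8 by (intro mult_right_mono) auto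
  ultimately show ?thesis by simp
qed

end

section \<open>Verification of the stability criterion along \<open>\<Theta>_star\<close>\<close>

theorem theorem2:
  fixes e C1 C2 \<Lambda>1 \<Lambda>2 M \<alpha>1 \<alpha>2 :: real
    and \<Lambda> :: "int \<Rightarrow> int \<Rightarrow> real"
  assumes "0 \<le> e" "e < 1"
    and "C1 > 0" "C2 > 0" "C1 + C2 = 1"
    and "\<Lambda>1 > 0" "\<Lambda>2 > 0"
    and "\<And>m1 m2. (m1, m2) \<in> Xi \<Longrightarrow> \<Lambda> m1 m2 > 0"
    and "\<And>m1 m2. (m1, m2) \<in> Xi \<Longrightarrow> \<Lambda> m1 m2 = \<Lambda> (- m1) (- m2)"
    and "1 / pi\<^sup>2 >
      1 / (1 - e) ^ 3 * (\<Lambda>1 / C1 + \<Lambda>2 / C2)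
      + 1 / (1 - e) ^ 5 *
          (\<Sum>(m1, m2)\<in>Xi. ((of_int m1)\<^sup>2 / C1 + (of_int m2)\<^sup>2 / C2) * \<Lambda> m1 m2)"
    and "M =
      1 / (1 - e) ^ 3 * max (\<Lambda>1 / C1) (\<Lambda>2 / C2)
      + 1 / (1 - e) ^ 5 *
          (\<Sum>(m1, m2)\<in>Xi. max (\<bar>of_int m1\<bar> / C1) (\<bar>of_int m2\<bar> / C2) * \<Lambda> m1 m2)
      + 4 * e * sqrt (1 - e\<^sup>2) / (1 - e) ^ 4"
    and "1 / (4 * pi) > M"
    and "\<alpha>1 * (\<Lambda>1 / C1) = 1 / (1 - e)\<^sup>2 *
          (\<Sum>(m1, m2)\<in>Xi. ((of_int m1)\<^sup>2 / C1 + \<bar>of_int (m1 * m2)\<bar> / sqrt (C1 * C2)) * \<Lambda> m1 m2)"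
    and "\<alpha>2 * (\<Lambda>2 / C2) = 1 / (1 - e)\<^sup>2 *
          (\<Sum>(m1, m2)\<in>Xi. ((of_int m2)\<^sup>2 / C2 + \<bar>of_int (m1 * m2)\<bar> / sqrt (C1 * C2)) * \<Lambda> m1 m2)"
    and "cos (2 * pi\<^sup>2 * M) * min (\<Lambda>1 / C1) (\<Lambda>2 / C2) > max (\<alpha>1 * (\<Lambda>1 / C1)) (\<alpha>2 * (\<Lambda>2 / C2))"
  shows "strongly_linearly_stable e C1 C2 \<Lambda>1 \<Lambda>2 \<Lambda> (\<Theta>_star e C1 C2 \<Lambda>1 \<Lambda>2 \<Lambda>)"
proof -
  interpret spin_spin e C1 C2 \<Lambda>1 \<Lambda>2 \<Lambda>
    using assms(1-8) by unfold_locales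
  define \<Theta> where "\<Theta> = \<Theta>_star e C1 C2 \<Lambda>1 \<Lambda>2 \<Lambda>"
  define c where "c = cos (2 * pi\<^sup>2 * M)"
  define \<kappa> where "\<kappa> = c * min (\<Lambda>1 / C1) (\<Lambda>2 / C2) - max (\<alpha>1 * (\<Lambda>1 / C1)) (\<alpha>2 * (\<Lambda>2 / C2))"
  have stiff: "stiffness < 1 / pi\<^sup>2" using assms(10) by (simp add: stiffness_def)
  have sol: "spin_solution_on UNIV e C1 C2 \<Lambda>1 \<Lambda>2 \<Lambda> \<Theta>" and op: "odd_periodic \<Theta>"
    unfolding \<Theta>_def by (rule \<Theta>_star_solution[OF stiff])+
  have cont: "continuous_on UNIV \<Theta>"
    using sol unfolding spin_solution_on_def
    by (metis UNIV_I has_vector_derivative_imp_continuous_on)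
  have \<Theta>_bound: "\<bar>\<Theta> t $ j\<bar> \<le> pi\<^sup>2 * M" for t j
    using spin_solution_bound[OF sol op assms(11)] .
  have M0: "0 \<le> M" using order_trans[OF abs_ge_zero \<Theta>_bound[of 0 1]] by (simp add: zero_le_mult_iff)
  \<comment> \<open>Multiplying \<open>M < 1 / (4 * pi)\<close> by \<open>2 * pi^2\<close> gives
    exactly \<open>pi / 2\<close>, so the cosine in the third hypothesis is nonnegative.\<close>
  have angle: "2 * pi\<^sup>2 * M < pi / 2"
    using assms(12) by (simp add: power2_eq_square field_simps)
  have c0: "0 \<le> c" unfolding c_def using angle M0 by (intro cos_ge_zero) (auto intro: order_trans[of _ 0])
  \<comment> \<open>The bound \<open>pi^2 * M\<close> on the components lies below the angle
    \<open>2 * pi^2 * M\<close>, and cosine decreases on \<open>[0, pi]\<close>.\<close>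
  have cos_ge: "c \<le> cos (\<Theta> t $ j)" for t j
  proof -
    have "pi\<^sup>2 * M \<le> 2 * pi\<^sup>2 * M" using M0 by simp
    then have "\<bar>\<Theta> t $ j\<bar> \<le> 2 * pi\<^sup>2 * M" using \<Theta>_bound[of t j] by linarith
    then have "cos (2 * pi\<^sup>2 * M) \<le> cos \<bar>\<Theta> t $ j\<bar>"
      using angle by (intro cos_monotone_0_pi_le) auto
    then show ?thesis by (simp add: c_def)
  qed
  have \<kappa>: "0 < \<kappa>" using assms(15) by (simp add: \<kappa>_def c_def)
  have couplings: "coupling1 / (1 - e)\<^sup>2 = \<alpha>1 * (\<Lambda>1 / C1)" "coupling2 / (1 - e)\<^sup>2 = \<alpha>2 * (\<Lambda>2 / C2)"
    unfolding coupling1_def coupling2_def assms(13,14) by simp_all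
  have "strongly_stable (2 * pi) (scaled_jacobian \<Theta>)"
  proof (rule strongly_stable_criterion)
    show "Hill_coefficient (2 * pi) (scaled_jacobian \<Theta>)"
      using op by (intro Hill_coefficient_scaled_jacobian cont) (simp add: odd_periodic_def)
    show "\<kappa> / 8 * (x \<bullet> x) \<le> (scaled_jacobian \<Theta> t *v x) \<bullet> x" for t x
      by (rule scaled_jacobian_lower[OF c0 cos_ge]) (use \<kappa> in \<open>auto simp: couplings \<kappa>_def\<close>)
    show "(scaled_jacobian \<Theta> t *v x) \<bullet> x \<le> stiffness * (x \<bullet> x)" for t x by (rule scaled_jacobian_upper)
    \<comment> \<open>For the period \<open>2 * pi\<close> the requirement
      \<open>lam * T^2 < 4\<close> is the first hypothesis again.\<close>
    show "stiffness * (2 * pi)\<^sup>2 < 4" using stiff by (simp add: field_simps power_mult_distrib)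
  qed (use \<kappa> in auto)
  then show ?thesis
    unfolding strongly_linearly_stable_def linearization_eq \<Theta>_def .
qed

end
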